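(* Let $n\ge 3$ and let $a,b$ be nonzero elements of $\mathbb{Z}/n\mathbb{Z}$. If $a\neq\pm b \bmod n$ and $k\in\mathbb{Z}/n\mathbb{Z}$ with $k\notin\{a-b,0,a,-b\}\bmod n$, then the weight one modular form $$s_{k+b-a}-s_k-s_b+s_a$$ for $\Gamma_1(n)$ has zeros only at the cusps of $X_1(n)$.
   Context: The Jacobi theta function is $\theta(z,\tau)=e^{\pi i\tau/4}(2\sin\pi z)\prod_{l\ge1}(1-e^{2\pi i l\tau})\prod_{l\ge1}(1-e^{2\pi i(l\tau+z)})\prod_{l\ge1}(1-e^{2\pi i(l\tau-z)})$ for $z\in\mathbb{C}$ and $\tau$ in the upper half-plane; $\theta_z$ is its partial derivative in $z$. For an integer $a$ not divisible by $n$, define $s_a(\tau)=\theta_z(\tfrac an,\tau)/\theta(\tfrac an,\tau)$. It depends only on $a\bmod n$, satisfies $s_{-a}=-s_a$, and is a modular form of weight $1$ for $\Gamma_1(n)$. *)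

theory Defs
  imports "HOL-Complex_Analysis.Complex_Analysis" "HOL-Number_Theory.Cong"
begin

section \<open>The Jacobi theta function and its logarithmic derivative at torsion points\<close>

definition upper_half_plane :: "complex set" where
  "upper_half_plane = {\<tau>. Im \<tau> > 0}"

text \<open>The products run over all \<open>l \<ge> 1\<close>; since \<^const>\<open>prodinf\<close> starts at 0, the index is shifted.\<close>

definition theta :: "complex \<Rightarrow> complex \<Rightarrow> complex" where
  "theta z \<tau> =
     exp (of_real pi * \<i> * \<tau> / 4) * (2 * sin (of_real pi * z)) *
     (\<Prod>l. 1 - exp (2 * of_real pi * \<i> * of_nat (Suc l) * \<tau>)) *
     (\<Prod>l. 1 - exp (2 * of_real pi * \<i> * (of_nat (Suc l) * \<tau> + z))) *
     (\<Prod>l. 1 - exp (2 * of_real pi * \<i> * (of_nat (Suc l) * \<tau> - z)))"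

definition theta_z :: "complex \<Rightarrow> complex \<Rightarrow> complex" where
  "theta_z z \<tau> = deriv (\<lambda>w. theta w \<tau>) z"

text \<open>Classes in \<open>\<int>/n\<close> are represented by arbitrary integers. The function is
  meaningful only when \<open>n\<close> does not divide \<open>a\<close>.\<close>

definition s :: "nat \<Rightarrow> int \<Rightarrow> complex \<Rightarrow> complex" where
  "s n a \<tau> = theta_z (of_int a / of_nat n) \<tau> / theta (of_int a / of_nat n) \<tau>"

section \<open>Modular forms\<close>

definition SL2Z :: "(int^2^2) set" where
  "SL2Z = {A. det A = 1}"

definition Gamma1 :: "nat \<Rightarrow> (int^2^2) set" where
  "Gamma1 n = {A \<in> SL2Z. [A $ 1 $ 1 = 1] (mod int n) \<and> [A $ 2 $ 1 = 0] (mod int n)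
                        \<and> [A $ 2 $ 2 = 1] (mod int n)}"

definition moebius_act :: "int^2^2 \<Rightarrow> complex \<Rightarrow> complex" where
  "moebius_act A \<tau> = (of_int (A $ 1 $ 1) * \<tau> + of_int (A $ 1 $ 2)) /
                   (of_int (A $ 2 $ 1) * \<tau> + of_int (A $ 2 $ 2))"

definition slash :: "int \<Rightarrow> int^2^2 \<Rightarrow> (complex \<Rightarrow> complex) \<Rightarrow> complex \<Rightarrow> complex" where
  "slash w A f \<tau> =
     (of_int (A $ 2 $ 1) * \<tau> + of_int (A $ 2 $ 2)) powi (- w) * f (moebius_act A \<tau>)"

text \<open>The filter \<open>\<tau> \<rightarrow> i\<infinity>\<close>, i.e. \<open>Im \<tau> \<rightarrow> \<infinity>\<close> uniformly in \<open>Re \<tau>\<close>.\<close>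

abbreviation at_ii_inf :: "complex filter" where
  "at_ii_inf \<equiv> filtercomap Im at_top"

text \<open>Holomorphy at the cusps is expressed as boundedness of every \<open>SL\<^sub>2(\<int>)\<close>-translate
  near \<open>i\<infinity>\<close>: such a translate is holomorphic and periodic, so boundedness says precisely
  that its Fourier expansion contains no negative powers of the local parameter.\<close>

definition modular_form :: "int \<Rightarrow> nat \<Rightarrow> (complex \<Rightarrow> complex) \<Rightarrow> bool" where
  "modular_form w n f \<longleftrightarrow>
     f holomorphic_on upper_half_plane \<and>
     (\<forall>A\<in>Gamma1 n. \<forall>\<tau>\<in>upper_half_plane. slash w A f \<tau> = f \<tau>) \<and>
     (\<forall>A\<in>SL2Z. \<exists>B. eventually (\<lambda>\<tau>. norm (slash w A f \<tau>) \<le> B) at_ii_inf)"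

section \<open>The modular curve $X_1(n)$, its cusps, and zeros of modular forms\<close>

text \<open>Points of \<open>\<complex> \<union> \<rat> \<union> {\<infinity>}\<close>, where the rationals are formally distinct from complex
  numbers. The extended upper half-plane is the subset \<open>hstar\<close> below.\<close>

datatype ext_point = Interior complex | Rational rat | Infinity

definition boundary_points :: "ext_point set" where
  "boundary_points = insert Infinity (range Rational)"

definition hstar :: "ext_point set" where
  "hstar = Interior ` upper_half_plane \<union> boundary_points"

fun ext_act :: "int^2^2 \<Rightarrow> ext_point \<Rightarrow> ext_point" where
  "ext_act A (Interior \<tau>) = Interior (moebius_act A \<tau>)"
| "ext_act A (Rational r) =
     (if of_int (A $ 2 $ 1) * r + of_int (A $ 2 $ 2) = 0 then Infinity
      else Rational ((of_int (A $ 1 $ 1) * r + of_int (A $ 1 $ 2)) /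
                     (of_int (A $ 2 $ 1) * r + of_int (A $ 2 $ 2))))"
| "ext_act A Infinity =
     (if A $ 2 $ 1 = 0 then Infinity
      else Rational (of_int (A $ 1 $ 1) / of_int (A $ 2 $ 1)))"

definition Gamma1_rel :: "nat \<Rightarrow> (ext_point \<times> ext_point) set" where
  "Gamma1_rel n = {(p, q). p \<in> hstar \<and> q \<in> hstar \<and> (\<exists>A\<in>Gamma1 n. q = ext_act A p)}"

definition X1 :: "nat \<Rightarrow> ext_point set set" where
  "X1 n = hstar // Gamma1_rel n"

definition cusps :: "nat \<Rightarrow> ext_point set set" where
  "cusps n = boundary_points // Gamma1_rel n"

text \<open>A form of weight \<open>w\<close> vanishes at a boundary point \<open>p = A \<infinity>\<close> if the constant term of
  the Fourier expansion of its translate by \<open>A\<close> is zero, i.e. the translate tends to 0.\<close>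

definition vanishes_at :: "int \<Rightarrow> (complex \<Rightarrow> complex) \<Rightarrow> ext_point \<Rightarrow> bool" where
  "vanishes_at w f p \<longleftrightarrow>
     (case p of
        Interior \<tau> \<Rightarrow> f \<tau> = 0
      | _ \<Rightarrow> (\<exists>A\<in>SL2Z. ext_act A Infinity = p \<and> (slash w A f \<longlongrightarrow> 0) at_ii_inf))"

text \<open>For a modular form, vanishing does not depend on the representative of a point of
  \<open>X\<^sub>1(n)\<close>.\<close>

definition zeros_X1 :: "int \<Rightarrow> nat \<Rightarrow> (complex \<Rightarrow> complex) \<Rightarrow> ext_point set set" where
  "zeros_X1 w n f = {x \<in> X1 n. \<exists>p\<in>x. vanishes_at w f p}"

end

theory Submission
  imports Defs
begin

text \<open>
  Write $Z(z) = \theta_z(z,\tau)/\theta(z,\tau)$ for a fixed $\tau$, so that $s_a(\tau) = Z(a/n)$.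
  With $x = k/n$, $y = b/n$ and $v = -a/n$ the form in question is
  $-(Z(x) + Z(y) + Z(v) - Z(x+y+v))$, because $Z$ is odd. The reason for the absence of zeros is
  the addition formula \<open>theta_logderiv_addition\<close>,
  \[ Z(x) + Z(y) + Z(v) - Z(x+y+v) =
     \frac{\theta_z(0)\,\theta(x+y)\,\theta(y+v)\,\theta(v+x)}
          {\theta(x)\,\theta(y)\,\theta(v)\,\theta(x+y+v)} . \]
  The theta function vanishes only on the lattice $\Lambda = \mathbb{Z}\tau + \mathbb{Z}$, and the
  congruence conditions on $a$, $b$, $k$ exclude each of the seven arguments from $\Lambda$. So
  the form has no zero in the upper half-plane, and every point of the modular curve at which it
  vanishes is a cusp.

  The addition formula and the transformation law \<open>theta_logderiv_moebius\<close> of $Z$ under the modular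
  group both follow from one principle, \<open>doubly_periodic_removable_constant\<close>: a doubly periodic
  function whose singularities are all removable is constant. In each case the difference of the two
  sides is doubly periodic, because $Z(z + m\tau + n) = Z(z) - 2\pi i m$; its poles cancel, because
  $Z$ has residue 1 at each lattice point; and the constant is zero because the difference vanishes at
  one point or is odd.

  The transformation law gives $s_a|A = Z(x\tau + y) + 2\pi i x$ with $x = ca/n$, $y = da/n$, where
  $(c, d)$ is the lower row of $A$ (\<open>slash_s\<close>). For $A \in \Gamma_1(n)$ the point $x\tau + y$ is a
  lattice translate of $a/n$, and the correction from the translation cancels $2\pi i x$. For general
  $A$, growth at the cusps is read off from the series for $Z$ obtained by logarithmic
  differentiation of the product; the same series shows that $s_a$ is holomorphic.
\<close>

section \<open>The infinite product $(e^{2\pi i z};q)_\infty$\<close>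

definition e1 :: "complex \<Rightarrow> complex" where
  "e1 z = exp (2 * of_real pi * \<i> * z)"

lemma e1_add: "e1 (z + w) = e1 z * e1 w"
  by (simp add: e1_def distrib_left exp_add)

lemma e1_nonzero [simp]: "e1 z \<noteq> 0"
  by (simp add: e1_def)

lemma norm_e1: "norm (e1 z) = exp (- 2 * pi * Im z)"
  by (simp add: e1_def)

lemma e1_eq_1_iff: "e1 z = 1 \<longleftrightarrow> (\<exists>n::int. z = of_int n)"
proof -
  have "e1 z = 1 \<longleftrightarrow> (\<exists>n::int. 2 * of_real pi * \<i> * z = 2 * of_real pi * \<i> * of_int n)"
    unfolding e1_def exp_eq_1 by (auto simp: complex_eq_iff)
  then show ?thesis by simp
qed

lemma e1_of_int [simp]: "e1 (of_int n) = 1"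
  by (auto simp: e1_eq_1_iff)

lemma e1_1 [simp]: "e1 1 = 1"
  using e1_of_int[of 1] by simp

lemma e1_0 [simp]: "e1 0 = 1"
  by (simp add: e1_def)

lemma e1_has_field_derivative [derivative_intros]:
  assumes "(f has_field_derivative f') (at z within A)"
  shows "((\<lambda>z. e1 (f z)) has_field_derivative 2 * of_real pi * \<i> * f' * e1 (f z)) (at z within A)"
  unfolding e1_def by (auto intro!: derivative_eq_intros assms)

lemma e1_holomorphic [holomorphic_intros]:
  "f holomorphic_on A \<Longrightarrow> (\<lambda>z. e1 (f z)) holomorphic_on A"
  unfolding e1_def by (intro holomorphic_intros)

text \<open>
  With $w = e^{2\pi i z}$ and $q = e^{2\pi i\tau}$ this is the Pochhammer symbol $(w;q)_\infty$. Starting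
  the product at $l = 0$ makes the theta function a multiple of $w^{-1/2}(w;q)_\infty(q/w;q)_\infty$,
  without a separate sine factor, and reduces its quasi-periodicity to a shift of the index.
\<close>
definition qprod :: "complex \<Rightarrow> complex \<Rightarrow> complex" where
  "qprod \<tau> z = (\<Prod>l. 1 - e1 (of_nat l * \<tau> + z))"

lemma norm_e1_nat: "norm (e1 (of_nat l * \<tau> + z)) = exp (- 2 * pi * Im z) * exp (- 2 * pi * Im \<tau>) ^ l"
  by (simp add: norm_e1 algebra_simps flip: exp_of_nat_mult exp_add)

lemma qprod_convergent:
  assumes "Im \<tau> > 0"
  shows "convergent_prod (\<lambda>l. 1 - e1 (of_nat l * \<tau> + z))"
proof -
  have "summable (\<lambda>l. norm ((1 - e1 (of_nat l * \<tau> + z)) - 1))"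
    using assms by (auto simp: norm_e1_nat intro!: summable_mult)
  then show ?thesis
    by (intro abs_convergent_prod_imp_convergent_prod summable_imp_abs_convergent_prod)
qed

text \<open>
  Uniformity on discs is what allows termwise logarithmic differentiation later on, besides giving
  holomorphy in $z$.
\<close>
lemma qprod_uniform_limit:
  assumes "Im \<tau> > 0"
  shows "uniform_limit (cball 0 R) (\<lambda>n z. \<Prod>l<n. 1 - e1 (of_nat l * \<tau> + z)) (qprod \<tau>) sequentially"
proof -
  let ?f = "\<lambda>l z. 1 - e1 (of_nat l * \<tau> + z)"
  have "uniformly_convergent_on (cball 0 R) (\<lambda>N z. \<Sum>n<N. norm (?f n z - 1))"
  proof (rule Weierstrass_m_test')
    fix l z assume "z \<in> cball (0::complex) R"
    then have "- Im z \<le> R"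
      using abs_Im_le_cmod[of z] by simp
    then have "- 2 * pi * Im z \<le> 2 * pi * R"
      using mult_left_mono[of "- Im z" R "2 * pi"] by simp
    then have "exp (- 2 * pi * Im z) * exp (- 2 * pi * Im \<tau>) ^ l \<le>
        exp (2 * pi * R) * exp (- 2 * pi * Im \<tau>) ^ l"
      by (intro mult_right_mono) auto
    then show "norm (norm (?f l z - 1)) \<le> exp (2 * pi * R) * exp (- 2 * pi * Im \<tau>) ^ l"
      by (simp add: norm_e1_nat)
  next
    show "summable (\<lambda>l. exp (2 * pi * R) * exp (- 2 * pi * Im \<tau>) ^ l)"
      using assms by (auto intro!: summable_mult)
  qed
  then have "uniformly_convergent_on (cball 0 R) (\<lambda>N z. \<Prod>n<N. ?f n z)"
    by (intro uniformly_convergent_on_prod') (auto simp: e1_def intro!: continuous_intros)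
  then have "uniform_limit (cball 0 R) (\<lambda>N z. \<Prod>n<N. ?f n z) (\<lambda>z. lim (\<lambda>N. \<Prod>n<N. ?f n z)) sequentially"
    by (simp add: uniformly_convergent_uniform_limit_iff)
  also have "(\<lambda>z. lim (\<lambda>N. \<Prod>n<N. ?f n z)) = qprod \<tau>"
    unfolding qprod_def
    by (intro ext limI has_prod_imp_tendsto' convergent_prod_has_prod qprod_convergent assms)
  finally show ?thesis .
qed

lemma qprod_entire:
  assumes "Im \<tau> > 0"
  shows "qprod \<tau> holomorphic_on UNIV"
proof (rule holomorphic_uniform_sequence)
  show "(\<lambda>z. \<Prod>l<n. 1 - e1 (of_nat l * \<tau> + z)) holomorphic_on UNIV" for n
    by (rule holomorphic_on_prod) (intro holomorphic_intros)
  show "\<exists>d>0. cball x d \<subseteq> UNIV \<and>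
      uniform_limit (cball x d) (\<lambda>n z. \<Prod>l<n. 1 - e1 (of_nat l * \<tau> + z)) (qprod \<tau>) sequentially" for x
  proof (intro exI conjI)
    show "uniform_limit (cball x 1) (\<lambda>n z. \<Prod>l<n. 1 - e1 (of_nat l * \<tau> + z)) (qprod \<tau>) sequentially"
    proof (rule uniform_limit_on_subset[OF qprod_uniform_limit[OF assms]])
      show "cball x 1 \<subseteq> cball 0 (norm x + 1)"
        by (subst cball_subset_cball_iff) (simp add: dist_norm)
    qed
  qed auto
qed auto

lemma qprod_holomorphic [holomorphic_intros]:
  assumes "Im \<tau> > 0" "f holomorphic_on A"
  shows "(\<lambda>z. qprod \<tau> (f z)) holomorphic_on A"
  using holomorphic_on_compose[OF assms(2) holomorphic_on_subset[OF qprod_entire[OF assms(1)]]]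
  by (simp add: o_def)

lemma qprod_eq_0_iff:
  assumes "Im \<tau> > 0"
  shows "qprod \<tau> z = 0 \<longleftrightarrow> (\<exists>l::nat. \<exists>n::int. of_nat l * \<tau> + z = of_int n)"
proof -
  have "(\<lambda>l. 1 - e1 (of_nat l * \<tau> + z)) has_prod qprod \<tau> z"
    unfolding qprod_def by (intro convergent_prod_has_prod qprod_convergent assms)
  then have "qprod \<tau> z = 0 \<longleftrightarrow> (\<exists>l::nat. e1 (of_nat l * \<tau> + z) = 1)"
    by (auto simp: has_prod_eq_0_iff image_iff)
  then show ?thesis by (simp add: e1_eq_1_iff)
qed

lemma qprod_add_1: "qprod \<tau> (z + 1) = qprod \<tau> z"
  by (simp add: qprod_def e1_add flip: add.assoc)

lemma qprod_shift:
  assumes "Im \<tau> > 0"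
  shows "qprod \<tau> z = (1 - e1 z) * qprod \<tau> (z + \<tau>)"
proof (cases "e1 z = 1")
  case True
  then have "qprod \<tau> z = 0"
    unfolding e1_eq_1_iff qprod_eq_0_iff[OF assms] by (intro exI[of _ "0::nat"]) simp
  with True show ?thesis by simp
next
  case False
  have "qprod \<tau> (z + \<tau>) = (\<Prod>l. 1 - e1 (of_nat (Suc l) * \<tau> + z))"
    by (simp add: qprod_def algebra_simps)
  also have "\<dots> = qprod \<tau> z / (1 - e1 z)"
    using False qprod_convergent[OF assms, of z] unfolding qprod_def
    by (subst prodinf_split_head) auto
  finally show ?thesis using False by simp
qed

text \<open>
  Up to the factor $-2\pi i$, the sum of the logarithmic derivatives of the factors of \<open>qprod\<close>.
\<close>
definition log_series :: "complex \<Rightarrow> complex \<Rightarrow> complex" where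
  "log_series \<tau> z = (\<Sum>l. e1 (of_nat l * \<tau> + z) / (1 - e1 (of_nat l * \<tau> + z)))"

lemma qprod_logderiv:
  assumes "Im \<tau> > 0" "qprod \<tau> z \<noteq> 0"
  shows "deriv (qprod \<tau>) z / qprod \<tau> z = - (2 * of_real pi * \<i> * log_series \<tau> z)"
proof -
  let ?f = "\<lambda>l z. 1 - e1 (of_nat l * \<tau> + z)"
  have lim: "uniform_limit (ball 0 (norm z + 1)) (\<lambda>n z. \<Prod>l<n. ?f l z) (qprod \<tau>) sequentially"
    by (rule uniform_limit_on_subset[OF qprod_uniform_limit[OF assms(1)]]) (rule ball_subset_cball)
  have "deriv (?f l) z = - (2 * of_real pi * \<i> * e1 (of_nat l * \<tau> + z))" for l
    by (intro DERIV_imp_deriv) (auto intro!: derivative_eq_intros)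
  moreover have "(\<lambda>l. deriv (?f l) z / ?f l z) sums (deriv (qprod \<tau>) z / qprod \<tau> z)"
    using lim by (rule logderiv_prodinf_complex_uniform_limit)
      (use assms in \<open>auto intro!: holomorphic_intros\<close>)
  ultimately have "(\<lambda>l. - (2 * of_real pi * \<i> * (e1 (of_nat l * \<tau> + z) / ?f l z))) sums
      (deriv (qprod \<tau>) z / qprod \<tau> z)"
    by simp
  moreover have "2 * of_real pi * \<i> \<noteq> (0::complex)" by simp
  ultimately have "(\<lambda>l. e1 (of_nat l * \<tau> + z) / ?f l z) sums
      (- (deriv (qprod \<tau>) z / qprod \<tau> z) / (2 * of_real pi * \<i>))"
    using sums_divide[OF sums_minus, of _ _ "2 * of_real pi * \<i>"] by fastforce
  then show ?thesis
    unfolding log_series_def by (simp add: sums_iff field_simps)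
qed

section \<open>Period lattices and doubly periodic functions\<close>

definition lattice :: "complex \<Rightarrow> complex set" where
  "lattice \<tau> = {of_int m * \<tau> + of_int n | m n. True}"

lemma lattice_add: "z \<in> lattice \<tau> \<Longrightarrow> w \<in> lattice \<tau> \<Longrightarrow> z + w \<in> lattice \<tau>"
proof -
  assume "z \<in> lattice \<tau>" "w \<in> lattice \<tau>"
  then obtain m n m' n' where "z = of_int m * \<tau> + of_int n" "w = of_int m' * \<tau> + of_int n'"
    by (auto simp: lattice_def)
  then have "z + w = of_int (m + m') * \<tau> + of_int (n + n')" by (simp add: algebra_simps)
  then show ?thesis unfolding lattice_def by blast
qed

lemma lattice_minus: "z \<in> lattice \<tau> \<Longrightarrow> - z \<in> lattice \<tau>"
proof -
  assume "z \<in> lattice \<tau>"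
  then obtain m n where "z = of_int m * \<tau> + of_int n"
    by (auto simp: lattice_def)
  then have "- z = of_int (- m) * \<tau> + of_int (- n)" by (simp add: algebra_simps)
  then show ?thesis unfolding lattice_def by blast
qed

lemma in_latticeI: "of_int m * \<tau> + of_int n \<in> lattice \<tau>"
  unfolding lattice_def by blast

lemma lattice_add_iff: "w \<in> lattice \<tau> \<Longrightarrow> z + w \<in> lattice \<tau> \<longleftrightarrow> z \<in> lattice \<tau>"
  using lattice_add[of "z + w" \<tau> "- w"] lattice_add[of z \<tau> w] lattice_minus[of w] by auto

lemma real_point_in_lattice_iff:
  assumes "Im \<tau> > 0"
  shows "of_real x * \<tau> + of_real y \<in> lattice \<tau> \<longleftrightarrow> x \<in> \<int> \<and> y \<in> \<int>"
proof
  assume "of_real x * \<tau> + of_real y \<in> lattice \<tau>"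
  then obtain m n where eq: "of_real x * \<tau> + of_real y = of_int m * \<tau> + of_int n"
    by (auto simp: lattice_def)
  then have "Im (of_real x * \<tau> + of_real y) = Im (of_int m * \<tau> + of_int n)" by simp
  with assms have x: "x = of_int m" by simp
  with eq have "complex_of_real y = of_int n" by simp
  then have "Re (complex_of_real y) = Re (of_int n)" by simp
  then have "y = of_int n" by simp
  with x show "x \<in> \<int> \<and> y \<in> \<int>" by simp
next
  assume "x \<in> \<int> \<and> y \<in> \<int>"
  then obtain m n where "x = of_int m" "y = of_int n" by (auto elim!: Ints_cases)
  then show "of_real x * \<tau> + of_real y \<in> lattice \<tau>"
    using in_latticeI[of m \<tau> n] by simp
qed

lemma int_shift_periodic:
  fixes f :: "complex \<Rightarrow> complex"
  assumes "\<And>z. f (z + w) = f z"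
  shows "f (z + of_int m * w) = f z"
proof (induction m rule: int_induct[where k = 0])
  case (step1 i)
  then show ?case
    using assms[of "z + of_int i * w"] by (simp add: algebra_simps)
next
  case (step2 i)
  then show ?case
    using assms[of "z + of_int (i - 1) * w"] by (simp add: algebra_simps)
qed simp

lemma doubly_periodic_lattice:
  fixes f :: "complex \<Rightarrow> complex"
  assumes "\<And>z. f (z + 1) = f z" "\<And>z. f (z + \<tau>) = f z"
  shows "f (z + (of_int m * \<tau> + of_int n)) = f z"
  using int_shift_periodic[of f 1 "z + of_int m * \<tau>" n] int_shift_periodic[of f \<tau> z m] assms
  by (simp add: add.assoc)

lemma open_nonzero_entire:
  assumes "h holomorphic_on UNIV"
  shows "open {z. h z \<noteq> (0::complex)}"
  by (intro open_Collect_neq holomorphic_on_imp_continuous_on assms) auto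

text \<open>
  Here $s$ and $t$ are the fractional parts of the real coordinates of $z$ in the basis $\tau, 1$. The
  ranges are taken closed so that the parallelogram is compact.
\<close>
lemma lattice_reduction:
  assumes "Im \<tau> > 0"
  obtains m n :: int and s t :: real where "0 \<le> s" "s \<le> 1" "0 \<le> t" "t \<le> 1"
    "z = (of_real s * \<tau> + of_real t) + (of_int m * \<tau> + of_int n)"
proof -
  define x where "x = Im z / Im \<tau>"
  define y where "y = Re z - x * Re \<tau>"
  have "z = of_real x * \<tau> + of_real y"
    using assms by (simp add: complex_eq_iff x_def y_def)
  also have "\<dots> = (of_real (frac x) * \<tau> + of_real (frac y)) + (of_int \<lfloor>x\<rfloor> * \<tau> + of_int \<lfloor>y\<rfloor>)"
    by (simp add: frac_def algebra_simps)
  finally show ?thesis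
    by (intro that[of "frac x" "frac y" "\<lfloor>x\<rfloor>" "\<lfloor>y\<rfloor>"]) (auto simp: less_imp_le frac_lt_1)
qed

lemma entire_doubly_periodic_constant:
  assumes "Im \<tau> > 0" "g holomorphic_on UNIV"
    and per: "\<And>z m n. g (z + (of_int m * \<tau> + of_int n)) = g z"
  shows "g constant_on UNIV"
proof (rule Liouville_theorem)
  let ?K = "(\<lambda>(s, t). of_real s * \<tau> + of_real t) ` ({0..1::real} \<times> {0..1::real})"
  have "compact ?K"
    by (rule compact_continuous_image[OF _ compact_Times])
      (auto intro!: continuous_intros simp: case_prod_unfold)
  then have "compact (g ` ?K)"
    by (rule compact_continuous_image[rotated])
      (auto intro: holomorphic_on_imp_continuous_on holomorphic_on_subset[OF assms(2)])
  then have "bounded (g ` ?K)" by (rule compact_imp_bounded)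
  moreover have "range g \<subseteq> g ` ?K"
  proof safe
    fix z
    obtain m n :: int and s t :: real where "0 \<le> s" "s \<le> 1" "0 \<le> t" "t \<le> 1"
      and z: "z = (of_real s * \<tau> + of_real t) + (of_int m * \<tau> + of_int n)"
      by (rule lattice_reduction[OF assms(1), of z])
    moreover have "g z = g (of_real s * \<tau> + of_real t)"
      unfolding z by (rule per)
    moreover have "of_real s * \<tau> + of_real t \<in> ?K" if "0 \<le> s" "s \<le> 1" "0 \<le> t" "t \<le> 1"
      using that by (intro image_eqI[of _ _ "(s, t)"]) auto
    ultimately show "g z \<in> g ` ?K" by simp
  qed
  ultimately show "bounded (range g)" by (rule bounded_subset)
qed fact

lemma eventually_nonzero_entire:
  assumes "h holomorphic_on UNIV" "h z0 \<noteq> 0"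
  shows "eventually (\<lambda>z. h z \<noteq> 0) (at z)"
proof (rule ccontr)
  assume "\<not> ?thesis"
  then have "z islimpt {z. h z = 0}"
    by (simp add: islimpt_conv_frequently_at frequently_def)
  then have "h z0 = 0"
    by (rule analytic_continuation[OF assms(1) open_UNIV connected_UNIV subset_UNIV UNIV_I]) auto
  with assms show False by simp
qed

text \<open>
  The exceptional set is given as the zero set of an entire function $h$, so that it is discrete by
  the identity theorem; in applications $h$ is a product of theta functions. Off this set $f$ is analytic
  and doubly periodic; at a zero of $h$ it suffices to check the limit after a lattice translation,
  so only one representative of each class of poles has to be examined. Filling in
  the removable singularities gives an entire doubly periodic function.
\<close>
lemma doubly_periodic_removable_constant:
  assumes tau: "Im \<tau> > 0"
    and h: "h holomorphic_on UNIV" "h z0 \<noteq> 0"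
    and f: "\<And>z. h z \<noteq> 0 \<Longrightarrow> f analytic_on {z}"
    and per: "\<And>z m n. h z \<noteq> 0 \<Longrightarrow> f (z + (of_int m * \<tau> + of_int n)) = f z"
    and sing: "\<And>p. h p = 0 \<Longrightarrow>
      \<exists>m n. ((\<lambda>w. w * f (p + (of_int m * \<tau> + of_int n) + w)) \<longlongrightarrow> 0) (at 0)"
  shows "\<exists>c. \<forall>z. h z \<noteq> 0 \<longrightarrow> f z = c"
proof -
  have ev: "eventually (\<lambda>w. h (p + w) \<noteq> 0) (at 0)" for p
    using eventually_nonzero_entire[OF h, of p]
    unfolding at_to_0[of p] eventually_filtermap by (simp add: add.commute)
  have per': "f (z + (of_int m * \<tau> + of_int n) + w) = f (z + w)" if "h (z + w) \<noteq> 0" for z w m n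
    using per[OF that, of m n] by (simp only: add_ac)
  have sing': "((\<lambda>z. (z - p) * f z) \<longlongrightarrow> 0) (at p)" if "h p = 0" for p
  proof -
    from sing[OF that] obtain m n where
      *: "((\<lambda>w. w * f (p + (of_int m * \<tau> + of_int n) + w)) \<longlongrightarrow> 0) (at 0)" by blast
    have "eventually (\<lambda>w. w * f (p + (of_int m * \<tau> + of_int n) + w) = w * f (p + w)) (at 0)"
      using ev[of p] by eventually_elim (simp add: per')
    with * have "((\<lambda>w. w * f (p + w)) \<longlongrightarrow> 0) (at 0)"
      by (rule Lim_transform_eventually)
    then show ?thesis
      unfolding at_to_0[of p] filterlim_filtermap by (simp add: add.commute)
  qed
  have iso: "isolated_singularity_at f p" and lim: "\<exists>c. f \<midarrow>p\<rightarrow> c" for p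
  proof -
    obtain r where r: "r > 0" "\<And>z. z \<noteq> p \<Longrightarrow> dist z p < r \<Longrightarrow> h z \<noteq> 0"
      using eventually_nonzero_entire[OF h, of p] unfolding eventually_at by auto
    have ana: "f analytic_on ball p r - {p}"
      unfolding analytic_on_analytic_at[of f "ball p r - {p}"]
      using r(2) by (intro ballI f) (auto simp: dist_commute)
    with r show "isolated_singularity_at f p"
      by (auto simp: isolated_singularity_at_def)
    show "\<exists>c. f \<midarrow>p\<rightarrow> c"
    proof (cases "h p = 0")
      case True
      have "f holomorphic_on ball p r - {p}"
        using ana by (rule analytic_imp_holomorphic)
      then obtain g where g: "g holomorphic_on ball p r" "\<forall>z\<in>ball p r - {p}. g z = f z"
        using holomorphic_on_extend_lim[of f "ball p r" p] sing'[OF True] r(1) by auto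
      have "isCont g p"
        using g(1) r(1) by (simp add: analytic_at_imp_isCont holomorphic_on_imp_analytic_at)
      then have "g \<midarrow>p\<rightarrow> g p" by (simp add: isContD)
      moreover have "eventually (\<lambda>z. z \<in> ball p r - {p}) (at p)"
        using r(1) by (intro eventually_at_in_open) auto
      then have "eventually (\<lambda>z. g z = f z) (at p)"
        by eventually_elim (use g(2) in auto)
      ultimately have "f \<midarrow>p\<rightarrow> g p" by (rule Lim_transform_eventually)
      then show ?thesis ..
    next
      case False
      with f have "isCont f p" by (simp add: analytic_at_imp_isCont)
      then have "f \<midarrow>p\<rightarrow> f p" by (rule isContD)
      then show ?thesis ..
    qed
  qed
  define g where "g = remove_sings f"
  have g_lim: "f \<midarrow>p\<rightarrow> g p" for p
  proof -
    from lim[of p] obtain c where "f \<midarrow>p\<rightarrow> c" ..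
    moreover from this have "g p = c" unfolding g_def by (rule remove_sings_eqI)
    ultimately show ?thesis by simp
  qed
  have "g analytic_on {z}" for z
    unfolding g_def by (rule remove_sings_analytic_at[OF iso g_lim[unfolded g_def]])
  then have "g analytic_on UNIV"
    by (subst analytic_on_analytic_at) simp
  then have "g holomorphic_on UNIV"
    by (rule analytic_imp_holomorphic)
  moreover have "g (z + (of_int m * \<tau> + of_int n)) = g z" for z m n
  proof -
    let ?w = "of_int m * \<tau> + of_int n"
    have "((\<lambda>u. f (u + (z + ?w))) \<longlongrightarrow> g (z + ?w)) (at 0)"
      using g_lim[of "z + ?w"] unfolding at_to_0[of "z + ?w"] filterlim_filtermap .
    moreover have "eventually (\<lambda>u. f (u + (z + ?w)) = f (u + z)) (at 0)"
      using ev[of z] by eventually_elim (subst (1 2) add.commute, simp add: per')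
    ultimately have "((\<lambda>u. f (u + z)) \<longlongrightarrow> g (z + ?w)) (at 0)"
      by (rule Lim_transform_eventually)
    moreover have "((\<lambda>u. f (u + z)) \<longlongrightarrow> g z) (at 0)"
      using g_lim[of z] unfolding at_to_0[of z] filterlim_filtermap .
    ultimately show ?thesis by (rule LIM_unique)
  qed
  ultimately have "g constant_on UNIV"
    by (rule entire_doubly_periodic_constant[OF tau])
  then obtain c where c: "\<And>z. g z = c" by (auto simp: constant_on_def)
  show ?thesis
  proof (intro exI allI impI)
    fix z assume "h z \<noteq> 0"
    then have "g z = f z"
      unfolding g_def by (intro remove_sings_at_analytic f)
    with c[of z] show "f z = c" by simp
  qed
qed

section \<open>Zeros and quasi-periodicity of the theta function\<close>

lemma theta_eq_sin_qprod:
  "theta z \<tau> = 2 * exp (of_real pi * \<i> * \<tau> / 4) * qprod \<tau> \<tau> *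
     (sin (of_real pi * z) * qprod \<tau> (\<tau> + z) * qprod \<tau> (\<tau> - z))"
  by (simp add: theta_def qprod_def e1_def algebra_simps)

lemma sin_pi_eq_e1:
  "2 * sin (of_real pi * z) = \<i> * exp (- (of_real pi * \<i> * z)) * (1 - e1 z)"
proof -
  have "e1 z = exp (of_real pi * \<i> * z) * exp (of_real pi * \<i> * z)"
    by (simp add: e1_def mult_ac flip: exp_add)
  then show ?thesis
    by (simp add: sin_exp_eq' exp_minus field_simps)
qed

text \<open>
  By $2\sin\pi z = i e^{-\pi i z}(1 - w)$ the sine supplies exactly the factor with $l = 0$ that the product
  over $q^l w$, $l \ge 1$, lacks.
\<close>
lemma theta_eq_qprod:
  assumes "Im \<tau> > 0"
  shows "theta z \<tau> = exp (of_real pi * \<i> * \<tau> / 4) * qprod \<tau> \<tau> * \<i> *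
     (exp (- (of_real pi * \<i> * z)) * qprod \<tau> z * qprod \<tau> (\<tau> - z))"
proof -
  have "theta z \<tau> = exp (of_real pi * \<i> * \<tau> / 4) * qprod \<tau> \<tau> *
     ((2 * sin (of_real pi * z)) * qprod \<tau> (z + \<tau>) * qprod \<tau> (\<tau> - z))"
    by (simp add: theta_eq_sin_qprod add.commute)
  also have "\<dots> = exp (of_real pi * \<i> * \<tau> / 4) * qprod \<tau> \<tau> * \<i> *
     (exp (- (of_real pi * \<i> * z)) * ((1 - e1 z) * qprod \<tau> (z + \<tau>)) * qprod \<tau> (\<tau> - z))"
    unfolding sin_pi_eq_e1 by simp
  finally show ?thesis
    unfolding qprod_shift[OF assms, symmetric] .
qed

lemma qprod_self_nonzero:
  assumes "Im \<tau> > 0"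
  shows "qprod \<tau> \<tau> \<noteq> 0"
proof
  assume "qprod \<tau> \<tau> = 0"
  then obtain l :: nat and n :: int where "of_nat l * \<tau> + \<tau> = of_int n"
    using assms by (auto simp: qprod_eq_0_iff)
  then have "Im (of_nat l * \<tau> + \<tau>) = Im (of_int n)" by simp
  then have "(1 + real l) * Im \<tau> = 0" by (simp add: algebra_simps)
  with assms show False by simp
qed

lemma theta_entire [holomorphic_intros]:
  assumes "Im \<tau> > 0" "f holomorphic_on A"
  shows "(\<lambda>z. theta (f z) \<tau>) holomorphic_on A"
  unfolding theta_eq_sin_qprod using assms by (auto intro!: holomorphic_intros)

lemma theta_minus: "theta (- z) \<tau> = - theta z \<tau>"
  by (simp add: theta_eq_sin_qprod)

lemma theta_0 [simp]: "theta 0 \<tau> = 0"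
  by (simp add: theta_eq_sin_qprod)

lemma theta_add_1:
  assumes "Im \<tau> > 0"
  shows "theta (z + 1) \<tau> = - theta z \<tau>"
proof -
  have "qprod \<tau> (\<tau> - z) = qprod \<tau> (\<tau> - (z + 1))"
    using qprod_add_1[of \<tau> "\<tau> - (z + 1)"] by (simp add: algebra_simps)
  moreover have "exp (- (of_real pi * \<i> * (z + 1))) = - exp (- (of_real pi * \<i> * z))"
    by (simp add: distrib_left exp_add exp_diff mult.commute[of _ "\<i>"])
  ultimately show ?thesis
    by (simp add: theta_eq_qprod[OF assms] qprod_add_1)
qed

lemma theta_add_tau:
  assumes "Im \<tau> > 0"
  shows "theta (z + \<tau>) \<tau> = - exp (- (of_real pi * \<i> * \<tau>)) * e1 (- z) * theta z \<tau>"
proof -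
  have 1: "qprod \<tau> (-z) = (1 - e1 (-z)) * qprod \<tau> (\<tau> - z)"
    using qprod_shift[OF assms, of "-z"] by (simp add: algebra_simps)
  have 2: "1 - e1 (-z) = - e1 (-z) * (1 - e1 z)"
    by (simp add: algebra_simps flip: e1_add)
  have 3: "exp (- (of_real pi * \<i> * (z + \<tau>))) = exp (- (of_real pi * \<i> * z)) * exp (- (of_real pi * \<i> * \<tau>))"
    by (simp add: algebra_simps flip: exp_add)
  show ?thesis
    unfolding theta_eq_qprod[OF assms] 3 using 1 2 qprod_shift[OF assms, of z]
    by simp
qed

text \<open>
  The zeros of $(w;q)_\infty$ are the lattice points $m\tau + n$ with $m \le 0$, and those of
  $(q/w;q)_\infty$ are the ones with $m \ge 1$; together they make up the whole lattice.
\<close>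
lemma theta_eq_0_iff:
  assumes "Im \<tau> > 0"
  shows "theta z \<tau> = 0 \<longleftrightarrow> z \<in> lattice \<tau>"
proof -
  have "theta z \<tau> = 0 \<longleftrightarrow> qprod \<tau> z = 0 \<or> qprod \<tau> (\<tau> - z) = 0"
    using qprod_self_nonzero[OF assms] by (simp add: theta_eq_qprod[OF assms])
  also have "qprod \<tau> z = 0 \<longleftrightarrow> (\<exists>l n. z = of_int (- int l) * \<tau> + of_int n)"
    unfolding qprod_eq_0_iff[OF assms] by (simp add: algebra_simps eq_diff_eq)
  also have "qprod \<tau> (\<tau> - z) = 0 \<longleftrightarrow> (\<exists>l n. z = of_int (int l + 1) * \<tau> + of_int (- n))"
    unfolding qprod_eq_0_iff[OF assms] by (intro ex_cong1) (auto simp: algebra_simps)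
  also have "(\<exists>l n. z = of_int (- int l) * \<tau> + of_int n) \<or>
      (\<exists>l n. z = of_int (int l + 1) * \<tau> + of_int (- n)) \<longleftrightarrow> z \<in> lattice \<tau>" (is "?L \<longleftrightarrow> ?R")
  proof
    assume ?R
    then obtain m n where z: "z = of_int m * \<tau> + of_int n" by (auto simp: lattice_def)
    show ?L
    proof (cases "m \<le> 0")
      case True
      with z show ?thesis by (intro disjI1 exI[of _ "nat (- m)"] exI[of _ n]) simp
    next
      case False
      with z show ?thesis by (intro disjI2 exI[of _ "nat (m - 1)"] exI[of _ "- n"]) simp
    qed
  qed (unfold lattice_def, blast)
  finally show ?thesis .
qed

text \<open>
  The zero at the origin is simple because only the sine contributes to it.
\<close>
lemma theta_z_0_nonzero:
  assumes "Im \<tau> > 0"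
  shows "theta_z 0 \<tau> \<noteq> 0"
proof -
  define h where "h = (\<lambda>z. 2 * exp (of_real pi * \<i> * \<tau> / 4) * qprod \<tau> \<tau> *
     (qprod \<tau> (\<tau> + z) * qprod \<tau> (\<tau> - z)))"
  have "h holomorphic_on UNIV"
    unfolding h_def by (intro holomorphic_intros assms)
  then have h': "(h has_field_derivative deriv h 0) (at 0)"
    by (intro holomorphic_derivI[of _ UNIV]) auto
  have "((\<lambda>z. sin (of_real pi * z) * h z) has_field_derivative
      of_real pi * h 0) (at 0)"
    by (auto intro!: derivative_eq_intros h')
  moreover have "(\<lambda>z. sin (of_real pi * z) * h z) = (\<lambda>z. theta z \<tau>)"
    by (auto simp: h_def theta_eq_sin_qprod)
  ultimately have "theta_z 0 \<tau> = of_real pi * h 0"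
    unfolding theta_z_def by (intro DERIV_imp_deriv) simp
  moreover have "h 0 \<noteq> 0"
    using qprod_self_nonzero[OF assms] by (simp add: h_def)
  ultimately show ?thesis by simp
qed

section \<open>The logarithmic derivative in the elliptic variable\<close>

definition theta_logderiv :: "complex \<Rightarrow> complex \<Rightarrow> complex" where
  "theta_logderiv \<tau> z = theta_z z \<tau> / theta z \<tau>"

lemma has_field_derivative_theta:
  assumes "Im \<tau> > 0"
  shows "((\<lambda>z. theta z \<tau>) has_field_derivative theta_z z \<tau>) (at z)"
  unfolding theta_z_def
  by (rule holomorphic_derivI[of _ UNIV]) (auto intro!: holomorphic_intros assms)

lemma has_field_derivative_theta' [derivative_intros]:
  assumes "Im \<tau> > 0" "(f has_field_derivative f') (at z within A)"
  shows "((\<lambda>z. theta (f z) \<tau>) has_field_derivative theta_z (f z) \<tau> * f') (at z within A)"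
  using DERIV_chain2[OF has_field_derivative_theta[OF assms(1)] assms(2)] .

lemma theta_z_entire:
  assumes "Im \<tau> > 0"
  shows "(\<lambda>z. theta_z z \<tau>) holomorphic_on UNIV"
  unfolding theta_z_def by (intro holomorphic_intros assms) auto

lemma theta_z_isCont:
  assumes "Im \<tau> > 0"
  shows "isCont (\<lambda>z. theta_z z \<tau>) z"
  using holomorphic_on_imp_continuous_on[OF theta_z_entire[OF assms]]
  by (simp add: continuous_on_eq_continuous_at)

text \<open>
  Formulated for a composition so that it can serve as an introduction rule for expressions such as
  $Z(z + y + v)$ or $Z(jz)$.
\<close>
lemma theta_logderiv_holomorphic [holomorphic_intros]:
  assumes "Im \<tau> > 0" "f holomorphic_on A" "\<And>z. z \<in> A \<Longrightarrow> f z \<notin> lattice \<tau>"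
  shows "(\<lambda>z. theta_logderiv \<tau> (f z)) holomorphic_on A"
proof -
  from holomorphic_on_compose[OF assms(2) holomorphic_on_subset[OF theta_z_entire[OF assms(1)]]]
  have "(\<lambda>z. theta_z (f z) \<tau>) holomorphic_on A" by (simp add: o_def)
  then show ?thesis
    unfolding theta_logderiv_def using assms by (auto intro!: holomorphic_intros simp: theta_eq_0_iff)
qed

lemma theta_logderiv_minus:
  assumes "Im \<tau> > 0"
  shows "theta_logderiv \<tau> (- z) = - theta_logderiv \<tau> z"
proof -
  have "((\<lambda>z. - theta (- z) \<tau>) has_field_derivative theta_z (- z) \<tau>) (at z)"
    by (auto intro!: derivative_eq_intros assms)
  then have "theta_z z \<tau> = theta_z (- z) \<tau>"
    unfolding theta_minus using DERIV_unique[OF has_field_derivative_theta[OF assms]] by simp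
  then show ?thesis by (simp add: theta_logderiv_def theta_minus)
qed

lemma theta_logderiv_add_1:
  assumes "Im \<tau> > 0"
  shows "theta_logderiv \<tau> (z + 1) = theta_logderiv \<tau> z"
proof -
  have "((\<lambda>z. theta (z + 1) \<tau>) has_field_derivative theta_z (z + 1) \<tau>) (at z)"
    by (auto intro!: derivative_eq_intros assms)
  moreover have "((\<lambda>z. - theta z \<tau>) has_field_derivative - theta_z z \<tau>) (at z)"
    by (auto intro!: derivative_eq_intros assms)
  ultimately have "theta_z (z + 1) \<tau> = - theta_z z \<tau>"
    unfolding theta_add_1[OF assms] using DERIV_unique by blast
  then show ?thesis by (simp add: theta_logderiv_def theta_add_1[OF assms])
qed

lemma theta_logderiv_add_tau:
  assumes "Im \<tau> > 0" "z \<notin> lattice \<tau>"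
  shows "theta_logderiv \<tau> (z + \<tau>) = theta_logderiv \<tau> z - 2 * of_real pi * \<i>"
proof -
  define c where "c = - exp (- (of_real pi * \<i> * \<tau>))"
  have c: "c \<noteq> 0" by (simp add: c_def)
  have "((\<lambda>z. theta (z + \<tau>) \<tau>) has_field_derivative theta_z (z + \<tau>) \<tau>) (at z)"
    by (auto intro!: derivative_eq_intros assms)
  moreover have "((\<lambda>z. c * e1 (- z) * theta z \<tau>) has_field_derivative
      c * e1 (- z) * (theta_z z \<tau> - 2 * of_real pi * \<i> * theta z \<tau>)) (at z)"
    by (auto intro!: derivative_eq_intros assms simp: algebra_simps)
  moreover have eq: "theta (z + \<tau>) \<tau> = c * e1 (- z) * theta z \<tau>" for z
    using theta_add_tau[OF assms(1)] by (simp add: c_def)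
  ultimately have "theta_z (z + \<tau>) \<tau> = c * e1 (- z) * (theta_z z \<tau> - 2 * of_real pi * \<i> * theta z \<tau>)"
    using DERIV_unique by simp
  with assms c show ?thesis
    by (simp add: theta_logderiv_def eq theta_eq_0_iff diff_divide_distrib)
qed

lemma theta_logderiv_add_lattice:
  assumes "Im \<tau> > 0" "z \<notin> lattice \<tau>"
  shows "theta_logderiv \<tau> (z + (of_int m * \<tau> + of_int n)) = theta_logderiv \<tau> z - 2 * of_real pi * \<i> * of_int m"
proof -
  have n: "theta_logderiv \<tau> (w + of_int n) = theta_logderiv \<tau> w" for w
    using int_shift_periodic[of "theta_logderiv \<tau>" 1 w n, OF theta_logderiv_add_1[OF assms(1)]] by simp
  have notin: "z + of_int m * \<tau> \<notin> lattice \<tau>" for m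
    using lattice_add_iff[OF in_latticeI[of m \<tau> 0], of z] assms(2) by simp
  have "theta_logderiv \<tau> (z + of_int m * \<tau>) = theta_logderiv \<tau> z - 2 * of_real pi * \<i> * of_int m"
  proof (induction m rule: int_induct[where k = 0])
    case (step1 i)
    have "theta_logderiv \<tau> (z + of_int (i + 1) * \<tau>) = theta_logderiv \<tau> (z + of_int i * \<tau> + \<tau>)"
      by (simp add: algebra_simps)
    also have "\<dots> = theta_logderiv \<tau> (z + of_int i * \<tau>) - 2 * of_real pi * \<i>"
      by (rule theta_logderiv_add_tau[OF assms(1) notin])
    finally have "theta_logderiv \<tau> (z + of_int (i + 1) * \<tau>) =
        theta_logderiv \<tau> (z + of_int i * \<tau>) - 2 * of_real pi * \<i>" .
    then show ?case
      unfolding step1.IH by (simp add: algebra_simps)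
  next
    case (step2 i)
    have "theta_logderiv \<tau> (z + of_int i * \<tau>) = theta_logderiv \<tau> (z + of_int (i - 1) * \<tau> + \<tau>)"
      by (simp add: algebra_simps)
    also have "\<dots> = theta_logderiv \<tau> (z + of_int (i - 1) * \<tau>) - 2 * of_real pi * \<i>"
      by (rule theta_logderiv_add_tau[OF assms(1) notin])
    finally have "theta_logderiv \<tau> (z + of_int (i - 1) * \<tau>) =
        theta_logderiv \<tau> (z + of_int i * \<tau>) + 2 * of_real pi * \<i>" by simp
    then show ?case
      unfolding step2.IH by (simp add: algebra_simps)
  qed simp
  with n[of "z + of_int m * \<tau>"] show ?thesis by (simp add: add.assoc)
qed

lemma theta_over_id:
  assumes "Im \<tau> > 0"
  shows "((\<lambda>z. z / theta z \<tau>) \<longlongrightarrow> inverse (theta_z 0 \<tau>)) (at 0)"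
proof -
  have "((\<lambda>z. theta z \<tau> / z) \<longlongrightarrow> theta_z 0 \<tau>) (at 0)"
    using has_field_derivative_theta[OF assms, of 0] by (simp add: has_field_derivative_iff)
  from tendsto_inverse[OF this theta_z_0_nonzero[OF assms]] show ?thesis
    by (simp add: field_simps)
qed

lemma theta_logderiv_residue:
  assumes "Im \<tau> > 0"
  shows "((\<lambda>z. z * theta_logderiv \<tau> z) \<longlongrightarrow> 1) (at 0)"
proof -
  have "((\<lambda>z. theta_z z \<tau>) \<longlongrightarrow> theta_z 0 \<tau>) (at 0)"
    by (rule isContD[OF theta_z_isCont[OF assms]])
  from tendsto_mult[OF theta_over_id[OF assms] this] show ?thesis
    using theta_z_0_nonzero[OF assms] by (simp add: theta_logderiv_def)
qed

text \<open>
  Logarithmic differentiation of $\theta = C\, e^{-\pi i z}\,(w;q)_\infty\,(q/w;q)_\infty$, where $C$ does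
  not depend on $z$.
\<close>
lemma theta_logderiv_series:
  assumes "Im \<tau> > 0" "z \<notin> lattice \<tau>"
  shows "theta_logderiv \<tau> z = - (of_real pi * \<i>) - 2 * of_real pi * \<i> * log_series \<tau> z
      + 2 * of_real pi * \<i> * log_series \<tau> (\<tau> - z)"
proof -
  define C where "C = exp (of_real pi * \<i> * \<tau> / 4) * qprod \<tau> \<tau> * \<i>"
  define E where "E = (\<lambda>z. exp (- (of_real pi * \<i> * z)))"
  have th: "theta z \<tau> = C * (E z * qprod \<tau> z * qprod \<tau> (\<tau> - z))" for z
    by (simp add: C_def E_def theta_eq_qprod[OF assms(1)])
  have nz: "C \<noteq> 0" "E z \<noteq> 0" "qprod \<tau> z \<noteq> 0" "qprod \<tau> (\<tau> - z) \<noteq> 0"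
    using assms theta_eq_0_iff[OF assms(1), of z] by (auto simp: th)
  have q: "(qprod \<tau> has_field_derivative deriv (qprod \<tau>) w) (at w)" for w
    by (rule holomorphic_derivI[OF qprod_entire[OF assms(1)]]) auto
  have q': "((\<lambda>z. qprod \<tau> (\<tau> - z)) has_field_derivative - deriv (qprod \<tau>) (\<tau> - z)) (at z)"
  proof -
    have "((\<lambda>z. \<tau> - z) has_field_derivative - 1) (at z)"
      by (auto intro!: derivative_eq_intros)
    from DERIV_chain2[OF q this] show ?thesis by simp
  qed
  have E: "(E has_field_derivative - (of_real pi * \<i>) * E z) (at z)"
    unfolding E_def by (auto intro!: derivative_eq_intros)
  have "((\<lambda>z. theta z \<tau>) has_field_derivative
     C * (- (of_real pi * \<i>) * E z * qprod \<tau> z * qprod \<tau> (\<tau> - z)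
        + E z * deriv (qprod \<tau>) z * qprod \<tau> (\<tau> - z)
        - E z * qprod \<tau> z * deriv (qprod \<tau>) (\<tau> - z))) (at z)"
    unfolding th by (auto intro!: derivative_eq_intros q q' E simp: algebra_simps)
  then have "theta_z z \<tau> =
     C * (- (of_real pi * \<i>) * E z * qprod \<tau> z * qprod \<tau> (\<tau> - z)
        + E z * deriv (qprod \<tau>) z * qprod \<tau> (\<tau> - z)
        - E z * qprod \<tau> z * deriv (qprod \<tau>) (\<tau> - z))"
    using DERIV_unique[OF has_field_derivative_theta[OF assms(1)]] by blast
  then have "theta_logderiv \<tau> z = - (of_real pi * \<i>) + deriv (qprod \<tau>) z / qprod \<tau> z
     - deriv (qprod \<tau>) (\<tau> - z) / qprod \<tau> (\<tau> - z)"
    unfolding theta_logderiv_def th using nz by (simp add: field_simps)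
  then show ?thesis
    using nz by (simp add: qprod_logderiv[OF assms(1)])
qed

lemma theta_isCont:
  assumes "Im \<tau> > 0"
  shows "isCont (\<lambda>z. theta z \<tau>) z"
  by (rule DERIV_isCont[OF has_field_derivative_theta[OF assms]])

lemma theta_logderiv_isCont:
  assumes "Im \<tau> > 0" "z \<notin> lattice \<tau>"
  shows "isCont (theta_logderiv \<tau>) z"
  unfolding theta_logderiv_def
  using assms by (intro isCont_divide theta_z_isCont theta_isCont) (simp_all add: theta_eq_0_iff)

section \<open>The addition formula\<close>

text \<open>
  As functions of $x$, both sides are doubly periodic with simple poles at $0$ and $-(y+v)$, which
  are distinct modulo the lattice, and the residues agree there. So the difference $G$ is constant, and
  at $x = -y$ it vanishes.
\<close>
theorem theta_logderiv_addition:
  assumes tau: "Im \<tau> > 0"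
    and notin: "x \<notin> lattice \<tau>" "y \<notin> lattice \<tau>" "v \<notin> lattice \<tau>" "x + y + v \<notin> lattice \<tau>" "y + v \<notin> lattice \<tau>"
  shows "theta_logderiv \<tau> x + theta_logderiv \<tau> y + theta_logderiv \<tau> v - theta_logderiv \<tau> (x + y + v) =
    theta_z 0 \<tau> * theta (x + y) \<tau> * theta (y + v) \<tau> * theta (v + x) \<tau> /
      (theta x \<tau> * theta y \<tau> * theta v \<tau> * theta (x + y + v) \<tau>)"
proof -
  define Z where "Z = theta_logderiv \<tau>"
  define \<kappa> where "\<kappa> = theta_z 0 \<tau> * theta (y + v) \<tau> / (theta y \<tau> * theta v \<tau>)"
  define R where "R = (\<lambda>z. theta (z + y) \<tau> * theta (z + v) \<tau> / (theta z \<tau> * theta (z + y + v) \<tau>))"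
  define G where "G = (\<lambda>z. Z z + Z y + Z v - Z (z + y + v) - \<kappa> * R z)"
  define h where "h = (\<lambda>z. theta z \<tau> * theta (z + y + v) \<tau>)"
  have nz: "theta x \<tau> \<noteq> 0" "theta y \<tau> \<noteq> 0" "theta v \<tau> \<noteq> 0" "theta (x + y + v) \<tau> \<noteq> 0" "theta (y + v) \<tau> \<noteq> 0"
    using notin by (auto simp: theta_eq_0_iff[OF tau])
  have h0: "h z = 0 \<longleftrightarrow> z \<in> lattice \<tau> \<or> z + y + v \<in> lattice \<tau>" for z
    by (simp add: h_def theta_eq_0_iff[OF tau])
  have hol: "h holomorphic_on UNIV"
    unfolding h_def by (intro holomorphic_intros tau)
  have "G holomorphic_on {z. h z \<noteq> 0}"
    unfolding G_def Z_def R_def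
    by (intro holomorphic_intros tau) (auto simp: h0 theta_eq_0_iff[OF tau])
  then have ana: "G analytic_on {z}" if "h z \<noteq> 0" for z
    using that by (intro holomorphic_on_imp_analytic_at[OF _ open_nonzero_entire[OF hol]]) auto
  have R_1: "R (z + 1) = R z" for z
    using theta_add_1[OF tau, of z] theta_add_1[OF tau, of "z + y"]
      theta_add_1[OF tau, of "z + v"] theta_add_1[OF tau, of "z + y + v"]
    by (simp add: R_def add_ac)
  have R_tau: "R (z + \<tau>) = R z" for z
  proof -
    define c where "c = - exp (- (of_real pi * \<i> * \<tau>)) * e1 (- z)"
    have "c \<noteq> 0" by (simp add: c_def)
    have shift: "theta (z + u + \<tau>) \<tau> = c * e1 (- u) * theta (z + u) \<tau>" for u
      unfolding theta_add_tau[OF tau] c_def using e1_add[of "- z" "- u"] by simp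
    have "theta (z + \<tau> + y) \<tau> = c * e1 (- y) * theta (z + y) \<tau>"
      "theta (z + \<tau> + v) \<tau> = c * e1 (- v) * theta (z + v) \<tau>"
      "theta (z + \<tau>) \<tau> = c * theta z \<tau>"
      "theta (z + \<tau> + y + v) \<tau> = c * (e1 (- y) * e1 (- v)) * theta (z + y + v) \<tau>"
      using shift[of y] shift[of v] shift[of 0] shift[of "y + v"]
      by (simp_all add: add_ac flip: e1_add)
    with \<open>c \<noteq> 0\<close> show ?thesis
      by (simp add: R_def)
  qed
  have per: "G (z + (of_int m * \<tau> + of_int n)) = G z" if "h z \<noteq> 0" for z m n
  proof -
    have "Z (z + (of_int m * \<tau> + of_int n)) = Z z - 2 * of_real pi * \<i> * of_int m"
      unfolding Z_def using that by (intro theta_logderiv_add_lattice[OF tau]) (simp add: h0)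
    moreover have "Z (z + y + v + (of_int m * \<tau> + of_int n)) = Z (z + y + v) - 2 * of_real pi * \<i> * of_int m"
      unfolding Z_def using that by (intro theta_logderiv_add_lattice[OF tau]) (simp add: h0)
    moreover have "R (z + (of_int m * \<tau> + of_int n)) = R z"
      by (rule doubly_periodic_lattice[of R, OF R_1 R_tau])
    moreover have "z + (of_int m * \<tau> + of_int n) + y + v = z + y + v + (of_int m * \<tau> + of_int n)"
      by (simp only: add_ac)
    ultimately show ?thesis
      unfolding G_def by (simp only:) simp
  qed
  \<comment> \<open>At the pole 0, both sides have residue 1.\<close>
  have lim0: "((\<lambda>w. w * G w) \<longlongrightarrow> 0) (at 0)"
  proof -
    have th: "((\<lambda>w. theta (w + u) \<tau>) \<longlongrightarrow> theta u \<tau>) (at 0)" for u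
    proof -
      have "((\<lambda>w. theta (w + u) \<tau>) \<longlongrightarrow> theta (0 + u) \<tau>) (at 0)"
        by (intro isCont_tendsto_compose[OF theta_isCont[OF tau]] tendsto_intros)
      then show ?thesis by simp
    qed
    have "((\<lambda>w. Z (w + (y + v))) \<longlongrightarrow> Z (0 + (y + v))) (at 0)"
      unfolding Z_def
      by (intro isCont_tendsto_compose[OF theta_logderiv_isCont[OF tau]] tendsto_intros)
        (use notin in simp)
    then have Zl: "((\<lambda>w. Z (w + (y + v))) \<longlongrightarrow> Z (y + v)) (at 0)" by simp
    have "((\<lambda>w. w * Z w + w * (Z y + Z v - Z (w + (y + v))) - \<kappa> * (w / theta w \<tau> *
        (theta (w + y) \<tau> * theta (w + v) \<tau> / theta (w + (y + v)) \<tau>))) \<longlongrightarrow>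
      1 + 0 * (Z y + Z v - Z (y + v)) - \<kappa> * (inverse (theta_z 0 \<tau>) *
        (theta y \<tau> * theta v \<tau> / theta (y + v) \<tau>))) (at 0)"
      unfolding Z_def[symmetric]
      by (intro tendsto_intros th Zl theta_over_id[OF tau] theta_logderiv_residue[OF tau, folded Z_def] nz)
    moreover have "1 + 0 * (Z y + Z v - Z (y + v)) - \<kappa> * (inverse (theta_z 0 \<tau>) *
        (theta y \<tau> * theta v \<tau> / theta (y + v) \<tau>)) = 0"
      using nz theta_z_0_nonzero[OF tau] by (simp add: \<kappa>_def field_simps)
    moreover have "w * Z w + w * (Z y + Z v - Z (w + (y + v))) - \<kappa> * (w / theta w \<tau> *
        (theta (w + y) \<tau> * theta (w + v) \<tau> / theta (w + (y + v)) \<tau>)) = w * G w" for w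
      by (simp add: G_def R_def algebra_simps)
    ultimately show ?thesis by simp
  qed
  \<comment> \<open>The reflection interchanges the two poles, so the second one needs no computation.\<close>
  have refl: "G (- (y + v) - u) = G u" for u
  proof -
    have "- (y + v) - u = - (u + y + v)" by simp
    then have "Z (- (y + v) - u) = - Z (u + y + v)"
      unfolding Z_def by (simp only: theta_logderiv_minus[OF tau])
    moreover have "- (y + v) - u + y + v = - u" by simp
    then have "Z (- (y + v) - u + y + v) = - Z u"
      unfolding Z_def by (simp only: theta_logderiv_minus[OF tau])
    moreover have "R (- (y + v) - u) = R u"
    proof -
      have "- (y + v) - u + y = - (u + v)" "- (y + v) - u + v = - (u + y)"
        "- (y + v) - u = - (u + y + v)" "- (y + v) - u + y + v = - u"
        by simp_all
      then show ?thesis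
        unfolding R_def by (simp only: theta_minus) (simp add: mult_ac)
    qed
    ultimately show ?thesis by (simp only: G_def) (simp add: algebra_simps)
  qed
  have sing: "\<exists>m n. ((\<lambda>w. w * G (p + (of_int m * \<tau> + of_int n) + w)) \<longlongrightarrow> 0) (at 0)" if "h p = 0" for p
    using that unfolding h0
  proof
    assume "p \<in> lattice \<tau>"
    then obtain m n where "p = of_int m * \<tau> + of_int n" by (auto simp: lattice_def)
    then have "p + (of_int (- m) * \<tau> + of_int (- n)) + w = w" for w by simp
    with lim0 show ?thesis by (intro exI[of _ "- m"] exI[of _ "- n"]) (simp only:)
  next
    assume "p + y + v \<in> lattice \<tau>"
    then obtain m n where "p + y + v = of_int m * \<tau> + of_int n" by (auto simp: lattice_def)
    then have "p = of_int m * \<tau> + of_int n - (y + v)" by (simp add: algebra_simps)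
    then have eq: "p + (of_int (- m) * \<tau> + of_int (- n)) + w = - (y + v) - (- w)" for w by simp
    have "filterlim uminus (at 0) (at (0::complex))"
      by (auto simp: filterlim_at intro!: tendsto_eq_intros simp: eventually_at_filter)
    from filterlim_compose[OF lim0 this] have "((\<lambda>w. - ((- w) * G (- w))) \<longlongrightarrow> - 0) (at 0)"
      by (intro tendsto_minus)
    then have "((\<lambda>w. w * G (- (y + v) - (- w))) \<longlongrightarrow> 0) (at 0)"
      unfolding refl by simp
    then show ?thesis unfolding eq[symmetric] by blast
  qed
  have "h x \<noteq> 0" using nz by (simp add: h_def)
  obtain c where c: "\<forall>z. h z \<noteq> 0 \<longrightarrow> G z = c"
    using doubly_periodic_removable_constant[OF tau hol \<open>h x \<noteq> 0\<close> ana per sing] ..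
  have "h (- y) \<noteq> 0"
    using nz by (simp add: h_def theta_minus)
  moreover have "G (- y) = 0"
    using theta_logderiv_minus[OF tau, of y] by (simp add: G_def R_def Z_def)
  ultimately have "G x = 0"
    using c \<open>h x \<noteq> 0\<close> by metis
  then show ?thesis
    by (simp add: G_def Z_def R_def \<kappa>_def algebra_simps)
qed

section \<open>Transformation under the modular group\<close>

lemma moebius_denominator_nonzero:
  fixes a b c d :: int
  assumes "Im \<tau> > 0" "a * d - b * c = 1"
  shows "of_int c * \<tau> + of_int d \<noteq> 0"
proof
  assume 0: "of_int c * \<tau> + of_int d = 0"
  then have "Im (of_int c * \<tau> + of_int d) = 0" by simp
  with assms(1) have "c = 0" by simp
  with 0 have "d = 0" by simp
  with \<open>c = 0\<close> assms(2) show False by simp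
qed

lemma moebius_Im:
  fixes a b c d :: int
  assumes "Im \<tau> > 0" "a * d - b * c = 1"
  shows "Im ((of_int a * \<tau> + of_int b) / (of_int c * \<tau> + of_int d)) > 0"
proof -
  let ?j = "of_int c * \<tau> + of_int d"
  have "?j \<noteq> 0" by (rule moebius_denominator_nonzero[OF assms])
  then have "(Re ?j)\<^sup>2 + (Im ?j)\<^sup>2 > 0"
    by (simp add: complex_neq_0)
  moreover have "Im (of_int a * \<tau> + of_int b) * Re ?j - Re (of_int a * \<tau> + of_int b) * Im ?j
      = of_int (a * d - b * c) * Im \<tau>"
    by (simp add: algebra_simps)
  ultimately show ?thesis
    using assms by (simp only: Im_divide) simp
qed

text \<open>
  In the variable $u$ both sides have simple poles with residue 1 exactly on $\Lambda_{\tau'}$, since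
  $j\Lambda_{\tau'} = \Lambda_\tau$. The term linear in $u$ compensates the failure of $Z$ to be periodic:
  translation by $m\tau' + n$ changes $Z(u,\tau')$ by $-2\pi i m$ and $jZ(ju,\tau)$ by
  $-2\pi i j(ma + nc)$. So the difference $D$ is constant, and it is zero because $D$ is odd.
\<close>
theorem theta_logderiv_moebius:
  fixes a b c d :: int
  assumes tau: "Im \<tau> > 0" and det: "a * d - b * c = 1"
  defines "j \<equiv> of_int c * \<tau> + of_int d"
  defines "\<tau>' \<equiv> (of_int a * \<tau> + of_int b) / j"
  assumes u: "u \<notin> lattice \<tau>'"
  shows "theta_logderiv \<tau>' u = j * theta_logderiv \<tau> (j * u) + 2 * of_real pi * \<i> * of_int c * (j * u)"
proof -
  have j: "j \<noteq> 0" unfolding j_def by (rule moebius_denominator_nonzero[OF tau det])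
  have tau': "Im \<tau>' > 0" unfolding \<tau>'_def j_def by (rule moebius_Im[OF tau det])
  have jtau': "j * \<tau>' = of_int a * \<tau> + of_int b" using j by (simp add: \<tau>'_def)
  have det': "of_int a * of_int d - of_int b * of_int c = (1 :: complex)"
    using det by (metis of_int_1 of_int_diff of_int_mult)
  have lat: "j * (of_int m * \<tau>' + of_int n) = of_int (m * a + n * c) * \<tau> + of_int (m * b + n * d)" for m n
  proof -
    have "j * (of_int m * \<tau>' + of_int n) = of_int m * (j * \<tau>') + of_int n * j"
      by (simp add: algebra_simps)
    then show ?thesis unfolding jtau' by (simp add: j_def algebra_simps)
  qed
  have notin: "j * z \<notin> lattice \<tau>" if "z \<notin> lattice \<tau>'" for z
  proof
    assume "j * z \<in> lattice \<tau>"
    then obtain m n where mn: "j * z = of_int m * \<tau> + of_int n" by (auto simp: lattice_def)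
    \<comment> \<open>The coefficients come from the inverse matrix.\<close>
    have "j * (of_int (d * m - c * n) * \<tau>' + of_int (a * n - b * m)) =
        of_int (m * (a * d - b * c)) * \<tau> + of_int (n * (a * d - b * c))"
      unfolding lat by (simp add: algebra_simps)
    also have "\<dots> = j * z" by (simp add: det mn)
    finally have "z = of_int (d * m - c * n) * \<tau>' + of_int (a * n - b * m)"
      using j by simp
    with that show False unfolding lattice_def by blast
  qed
  define D where "D = (\<lambda>z. theta_logderiv \<tau>' z - j * theta_logderiv \<tau> (j * z) - 2 * of_real pi * \<i> * of_int c * (j * z))"
  define h where "h = (\<lambda>z. theta z \<tau>')"
  have h0: "h z = 0 \<longleftrightarrow> z \<in> lattice \<tau>'" for z
    by (simp add: h_def theta_eq_0_iff[OF tau'])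
  have hol: "h holomorphic_on UNIV"
    unfolding h_def by (intro holomorphic_intros tau')
  have "D holomorphic_on {z. h z \<noteq> 0}"
    unfolding D_def by (intro holomorphic_intros tau tau') (use notin in \<open>auto simp: h0\<close>)
  then have ana: "D analytic_on {z}" if "h z \<noteq> 0" for z
    using that by (intro holomorphic_on_imp_analytic_at[OF _ open_nonzero_entire[OF hol]]) auto
  have per: "D (z + (of_int m * \<tau>' + of_int n)) = D z" if "h z \<noteq> 0" for z m n
  proof -
    have z: "z \<notin> lattice \<tau>'" using that by (simp add: h0)
    have 1: "theta_logderiv \<tau>' (z + (of_int m * \<tau>' + of_int n)) = theta_logderiv \<tau>' z - 2 * of_real pi * \<i> * of_int m"
      by (rule theta_logderiv_add_lattice[OF tau' z])
    have 2: "theta_logderiv \<tau> (j * (z + (of_int m * \<tau>' + of_int n))) =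
        theta_logderiv \<tau> (j * z) - 2 * of_real pi * \<i> * of_int (m * a + n * c)"
      unfolding distrib_left[of j z] lat by (rule theta_logderiv_add_lattice[OF tau notin[OF z]])
    \<comment> \<open>The three corrections cancel because the determinant is 1.\<close>
    have 3: "of_int m + of_int c * (j * (of_int m * \<tau>' + of_int n)) = j * of_int (m * a + n * c)"
    proof -
      have "j * of_int (m * a + n * c) - of_int c * (j * (of_int m * \<tau>' + of_int n)) =
        of_int m * (of_int a * of_int d - of_int b * of_int c)"
        unfolding lat by (simp add: j_def algebra_simps)
      then show ?thesis unfolding det' by (simp add: algebra_simps)
    qed
    have "D (z + (of_int m * \<tau>' + of_int n)) - D z = 2 * of_real pi * \<i> *
        (j * of_int (m * a + n * c) - (of_int m + of_int c * (j * (of_int m * \<tau>' + of_int n))))"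
      unfolding D_def 1 2 by (simp add: distrib_left[of j z] right_diff_distrib distrib_left[of _ "j * z"] mult.assoc mult.left_commute)
        (simp add: algebra_simps)
    then show ?thesis unfolding 3 by simp
  qed
  have lim0: "((\<lambda>w. w * D w) \<longlongrightarrow> 0) (at 0)"
  proof -
    have "filterlim (\<lambda>w. j * w) (at 0) (at 0)"
      using j by (auto simp: filterlim_at intro!: tendsto_eq_intros simp: eventually_at_filter)
    from filterlim_compose[OF theta_logderiv_residue[OF tau] this]
    have "((\<lambda>w. j * w * theta_logderiv \<tau> (j * w)) \<longlongrightarrow> 1) (at 0)" .
    then have "((\<lambda>w. w * theta_logderiv \<tau>' w - j * w * theta_logderiv \<tau> (j * w)
        - w * (2 * of_real pi * \<i> * of_int c * (j * w))) \<longlongrightarrow>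
        1 - 1 - 0 * (2 * of_real pi * \<i> * of_int c * (j * 0))) (at 0)"
      by (intro tendsto_intros theta_logderiv_residue[OF tau'])
    then show ?thesis by (simp add: D_def algebra_simps)
  qed
  have sing: "\<exists>m n. ((\<lambda>w. w * D (p + (of_int m * \<tau>' + of_int n) + w)) \<longlongrightarrow> 0) (at 0)" if "h p = 0" for p
  proof -
    from that obtain m n where "p = of_int m * \<tau>' + of_int n" unfolding h0 by (auto simp: lattice_def)
    then have "p + (of_int (- m) * \<tau>' + of_int (- n)) + w = w" for w by simp
    with lim0 show ?thesis by (intro exI[of _ "- m"] exI[of _ "- n"]) (simp only:)
  qed
  have "h u \<noteq> 0" using u by (simp add: h0)
  obtain k where k: "\<forall>z. h z \<noteq> 0 \<longrightarrow> D z = k"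
    using doubly_periodic_removable_constant[OF tau' hol \<open>h u \<noteq> 0\<close> ana per sing] ..
  have "h (- u) \<noteq> 0"
    using \<open>h u \<noteq> 0\<close> by (simp add: h_def theta_minus)
  moreover have "D (- u) = - D u"
    using theta_logderiv_minus[OF tau', of u] theta_logderiv_minus[OF tau, of "j * u"]
    by (simp add: D_def algebra_simps)
  ultimately have "D u = - D u"
    using k \<open>h u \<noteq> 0\<close> by metis
  then have "D u + D u = 0"
    by (rule eq_neg_iff_add_eq_0[THEN iffD1])
  then have "D u = 0"
    unfolding mult_2[symmetric] by simp
  then show ?thesis by (simp add: D_def algebra_simps)
qed

section \<open>Growth towards $i\infty$\<close>

lemma eventually_at_ii_infI:
  assumes "\<And>\<tau>. Im \<tau> > C \<Longrightarrow> P \<tau>"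
  shows "eventually P at_ii_inf"
  unfolding eventually_filtercomap using assms eventually_gt_at_top[of C] by blast

text \<open>
  The term with index $l$ has $|q^l w| = |q|^{l+x}$. For $l \ge 1$ it is dominated by a geometric series,
  uniformly on every half-plane $\mathrm{Im}\,\tau > \delta > 0$, which yields both claims at once. The
  term with $l = 0$ is treated separately: its denominator $1 - w$ stays away from zero because
  $|w| = |q|^x$ is small for $x > 0$, while for $x = 0$ it is a nonzero constant.
\<close>
lemma log_series_along_line:
  fixes x y :: real
  assumes x: "x \<ge> 0" and xy: "x > 0 \<or> y \<notin> \<int>"
  shows log_series_holomorphic:
      "(\<lambda>\<tau>. log_series \<tau> (of_real x * \<tau> + of_real y)) holomorphic_on upper_half_plane"
    and log_series_bounded:
      "\<exists>B. eventually (\<lambda>\<tau>. norm (log_series \<tau> (of_real x * \<tau> + of_real y)) \<le> B) at_ii_inf"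
proof -
  define e where "e = (\<lambda>l \<tau>. e1 (of_nat l * \<tau> + (of_real x * \<tau> + of_real y)))"
  define t where "t = (\<lambda>l \<tau>. e l \<tau> / (1 - e l \<tau>))"
  define T where "T = (\<lambda>\<tau>. \<Sum>l. t (Suc l) \<tau>)"
  have norm_e: "norm (e l \<tau>) = exp (- 2 * pi * ((real l + x) * Im \<tau>))" for l \<tau>
    by (simp add: e_def norm_e1 algebra_simps)
  have bound: "norm (e (Suc l) \<tau>) \<le> exp (- 2 * pi * \<delta>) ^ Suc l"
    if "\<delta> > 0" "Im \<tau> > \<delta>" for \<delta> \<tau> l
  proof -
    have "real (Suc l) * \<delta> \<le> (real (Suc l) + x) * Im \<tau>"
      using that x by (intro mult_mono) auto
    then have "- 2 * pi * ((real (Suc l) + x) * Im \<tau>) \<le> real (Suc l) * (- 2 * pi * \<delta>)"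
      using mult_left_mono[of "real (Suc l) * \<delta>" "(real (Suc l) + x) * Im \<tau>" "2 * pi"] by (simp add: mult_ac)
    then have "exp (- 2 * pi * ((real (Suc l) + x) * Im \<tau>)) \<le> exp (real (Suc l) * (- 2 * pi * \<delta>))"
      by (subst exp_le_cancel_iff)
    then show ?thesis
      unfolding norm_e exp_of_nat_mult .
  qed
  define r where "r = (\<lambda>\<delta>::real. exp (- 2 * pi * \<delta>))"
  have r: "r \<delta> > 0" "\<delta> > 0 \<Longrightarrow> r \<delta> < 1" for \<delta>
    by (auto simp: r_def)
  have norm_t: "norm (t (Suc l) \<tau>) \<le> r \<delta> ^ Suc l / (1 - r \<delta>)" and e_ne: "1 - e (Suc l) \<tau> \<noteq> 0"
    if "\<delta> > 0" "Im \<tau> > \<delta>" for \<delta> \<tau> l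
  proof -
    have le: "norm (e (Suc l) \<tau>) \<le> r \<delta> ^ Suc l"
      using bound[OF that] by (simp only: r_def)
    have "r \<delta> ^ Suc l \<le> r \<delta>"
      using r[of \<delta>] that by (intro power_le_one_iff[THEN iffD2] order.trans[OF power_decreasing[of 1 "Suc l" "r \<delta>"]]) auto
    then have "1 - r \<delta> \<le> 1 - norm (e (Suc l) \<tau>)" using le by simp
    also have "\<dots> \<le> norm (1 - e (Suc l) \<tau>)"
      using norm_triangle_ineq2[of 1 "e (Suc l) \<tau>"] by simp
    finally have ge: "1 - r \<delta> \<le> norm (1 - e (Suc l) \<tau>)" .
    then show "1 - e (Suc l) \<tau> \<noteq> 0"
      using r(2)[OF that(1)] by auto
    show "norm (t (Suc l) \<tau>) \<le> r \<delta> ^ Suc l / (1 - r \<delta>)"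
      unfolding t_def norm_divide by (intro frac_le le ge) (use r[of \<delta>] that in auto)
  qed
  have summ: "summable (\<lambda>l. r \<delta> ^ Suc l / (1 - r \<delta>))" if "\<delta> > 0" for \<delta>
    using r[of \<delta>] that by (intro summable_divide summable_Suc_iff[THEN iffD2] summable_geometric) auto
  define S where "S = (\<lambda>\<delta>. {\<tau>. Im \<tau> > \<delta>})"
  have openS: "open (S \<delta>)" for \<delta>
    unfolding S_def by (rule open_halfspace_Im_gt)
  have T_hol: "T holomorphic_on S \<delta>" if "\<delta> > 0" for \<delta>
  proof (rule holomorphic_uniform_sequence[OF openS])
    show "(\<lambda>\<tau>. \<Sum>l<n. t (Suc l) \<tau>) holomorphic_on S \<delta>" for n
      unfolding t_def using e_ne[OF that]
      by (intro holomorphic_intros) (auto simp: S_def e_def intro!: holomorphic_intros)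
    have ul: "uniform_limit (S \<delta>) (\<lambda>n \<tau>. \<Sum>l<n. t (Suc l) \<tau>) T sequentially"
      unfolding T_def by (rule Weierstrass_m_test[OF norm_t[OF that] summ[OF that]]) (simp add: S_def)
    show "\<exists>d>0. cball \<tau> d \<subseteq> S \<delta> \<and> uniform_limit (cball \<tau> d) (\<lambda>n \<tau>. \<Sum>l<n. t (Suc l) \<tau>) T sequentially"
      if "\<tau> \<in> S \<delta>" for \<tau>
    proof -
      obtain d where "d > 0" "cball \<tau> d \<subseteq> S \<delta>"
        using openS[of \<delta>] \<open>\<tau> \<in> S \<delta>\<close> unfolding open_contains_cball by blast
      then show ?thesis
        using uniform_limit_on_subset[OF ul] by blast
    qed
  qed
  have T_bound: "norm (T \<tau>) \<le> (\<Sum>l. r 1 ^ Suc l / (1 - r 1))" if "Im \<tau> > 1" for \<tau>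
    unfolding T_def by (rule norm_suminf_le[OF norm_t summ]) (use that in auto)
  have split: "log_series \<tau> (of_real x * \<tau> + of_real y) = t 0 \<tau> + T \<tau>" if "\<tau> \<in> S \<delta>" "\<delta> > 0" for \<tau> \<delta>
  proof -
    have "summable (\<lambda>l. t (Suc l) \<tau>)"
      by (rule summable_comparison_test'[OF summ[OF that(2)] norm_t]) (use that in \<open>auto simp: S_def\<close>)
    then have "summable (\<lambda>l. t l \<tau>)"
      by (rule summable_Suc_iff[of "\<lambda>l. t l \<tau>", THEN iffD1])
    from suminf_split_head[OF this] show ?thesis
      by (simp add: log_series_def t_def e_def T_def)
  qed
  have e0_ne: "1 - e 0 \<tau> \<noteq> 0" if "Im \<tau> > 0" for \<tau>
  proof (cases "x = 0")
    case True
    with xy have "\<nexists>n. complex_of_real y = of_int n"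
      by (metis Ints_of_int of_real_eq_iff of_real_of_int_eq order_less_irrefl)
    then show ?thesis using True by (simp add: e_def e1_eq_1_iff)
  next
    case False
    with x that have "norm (e 0 \<tau>) < 1" by (simp add: norm_e)
    then show ?thesis by auto
  qed
  have hol: "(\<lambda>\<tau>. log_series \<tau> (of_real x * \<tau> + of_real y)) holomorphic_on S \<delta>" if "\<delta> > 0" for \<delta>
  proof -
    have "(\<lambda>\<tau>. t 0 \<tau> + T \<tau>) holomorphic_on S \<delta>"
      unfolding t_def using e0_ne that
      by (intro holomorphic_intros T_hol) (auto simp: S_def e_def intro!: holomorphic_intros)
    then show ?thesis
      by (rule holomorphic_transform) (simp add: split[OF _ that])
  qed
  have "(\<lambda>\<tau>. log_series \<tau> (of_real x * \<tau> + of_real y)) holomorphic_on (\<Union>\<delta>\<in>{0<..}. S \<delta>)"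
    by (rule holomorphic_on_UN_open) (use hol openS in auto)
  moreover have "(\<Union>\<delta>\<in>{0<..}. S \<delta>) = upper_half_plane"
    using dense by (auto simp: S_def upper_half_plane_def)
  ultimately show "(\<lambda>\<tau>. log_series \<tau> (of_real x * \<tau> + of_real y)) holomorphic_on upper_half_plane"
    by simp
  have "\<exists>C. \<forall>\<tau>. Im \<tau> > 1 \<longrightarrow> norm (t 0 \<tau>) \<le> C"
  proof (cases "x = 0")
    case True
    then have "t 0 \<tau> = t 0 0" for \<tau> by (simp add: t_def e_def)
    then show ?thesis by (metis order_refl)
  next
    case False
    have "norm (t 0 \<tau>) \<le> 1 / (1 - exp (- 2 * pi * x))" if "Im \<tau> > 1" for \<tau>
    proof -
      have "x * 1 \<le> x * Im \<tau>" using that x by (intro mult_left_mono) auto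
      then have le: "norm (e 0 \<tau>) \<le> exp (- 2 * pi * x)" by (simp add: norm_e)
      have "1 - exp (- 2 * pi * x) \<le> norm (1 - e 0 \<tau>)"
        using norm_triangle_ineq2[of 1 "e 0 \<tau>"] le by simp
      moreover have "exp (- 2 * pi * x) < 1" using False x by simp
      ultimately show ?thesis
        unfolding t_def norm_divide by (intro frac_le) (use le in \<open>auto intro: order.trans\<close>)
    qed
    then show ?thesis by blast
  qed
  then obtain C where C: "\<And>\<tau>. Im \<tau> > 1 \<Longrightarrow> norm (t 0 \<tau>) \<le> C" by blast
  have "norm (log_series \<tau> (of_real x * \<tau> + of_real y)) \<le> C + (\<Sum>l. r 1 ^ Suc l / (1 - r 1))"
    if "Im \<tau> > 1" for \<tau>
    using norm_triangle_mono[OF C[OF that] T_bound[OF that]] split[of \<tau> 1] that by (simp add: S_def)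
  then show "\<exists>B. eventually (\<lambda>\<tau>. norm (log_series \<tau> (of_real x * \<tau> + of_real y)) \<le> B) at_ii_inf"
    by (intro exI eventually_at_ii_infI)
qed

lemma theta_logderiv_series_on_line:
  fixes x y :: real
  assumes "Im \<tau> > 0" "x \<notin> \<int> \<or> y \<notin> \<int>"
  shows "theta_logderiv \<tau> (of_real x * \<tau> + of_real y) = - (of_real pi * \<i>)
      - 2 * of_real pi * \<i> * log_series \<tau> (of_real x * \<tau> + of_real y)
      + 2 * of_real pi * \<i> * log_series \<tau> (of_real (1 - x) * \<tau> + of_real (- y))"
proof -
  have "\<tau> - (of_real x * \<tau> + of_real y) = of_real (1 - x) * \<tau> + of_real (- y)"
    by (simp add: algebra_simps)
  moreover have "of_real x * \<tau> + of_real y \<notin> lattice \<tau>"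
    using assms by (simp add: real_point_in_lattice_iff)
  ultimately show ?thesis
    using theta_logderiv_series[OF assms(1)] by metis
qed

lemma bounded_at_ii_inf_lincomb:
  fixes f g :: "complex \<Rightarrow> complex"
  assumes "\<exists>B. eventually (\<lambda>\<tau>. norm (f \<tau>) \<le> B) at_ii_inf" "\<exists>B. eventually (\<lambda>\<tau>. norm (g \<tau>) \<le> B) at_ii_inf"
  shows "\<exists>B. eventually (\<lambda>\<tau>. norm (c + a * f \<tau> + b * g \<tau>) \<le> B) at_ii_inf"
proof -
  from assms obtain B B' where "eventually (\<lambda>\<tau>. norm (f \<tau>) \<le> B) at_ii_inf"
    "eventually (\<lambda>\<tau>. norm (g \<tau>) \<le> B') at_ii_inf" by blast
  then have "eventually (\<lambda>\<tau>. norm (c + a * f \<tau> + b * g \<tau>) \<le> norm c + norm a * B + norm b * B') at_ii_inf"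
  proof eventually_elim
    case (elim \<tau>)
    then have "norm (a * f \<tau>) \<le> norm a * B" "norm (b * g \<tau>) \<le> norm b * B'"
      by (simp_all add: norm_mult mult_left_mono)
    then show ?case
      by (intro norm_triangle_mono order_refl)
  qed
  then show ?thesis ..
qed

lemma eventually_Im_pos: "eventually (\<lambda>\<tau>. Im \<tau> > 0) at_ii_inf"
  by (rule eventually_at_ii_infI[of 0])

text \<open>
  A lattice translation brings $x$ into $[0,1)$. Then both $x$ and $1 - x$ are nonnegative, as required
  for the two series in the expansion of $Z$, and the case $x = 0$ is harmless because then $y$ is not an
  integer.
\<close>
lemma theta_logderiv_bounded_at_ii_inf:
  fixes x y :: real
  assumes "x \<notin> \<int> \<or> y \<notin> \<int>"
  shows "\<exists>B. eventually (\<lambda>\<tau>. norm (theta_logderiv \<tau> (of_real x * \<tau> + of_real y)) \<le> B) at_ii_inf"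
proof -
  let ?L = "\<lambda>\<tau>. log_series \<tau> (of_real (frac x) * \<tau> + of_real y)"
  let ?L' = "\<lambda>\<tau>. log_series \<tau> (of_real (1 - frac x) * \<tau> + of_real (- y))"
  have 1: "\<exists>B. eventually (\<lambda>\<tau>. norm (?L \<tau>) \<le> B) at_ii_inf"
    using assms by (intro log_series_bounded) (auto simp: frac_gt_0_iff)
  have 2: "\<exists>B. eventually (\<lambda>\<tau>. norm (?L' \<tau>) \<le> B) at_ii_inf"
    using frac_lt_1[of x] by (intro log_series_bounded) auto
  define c where "c = - 2 * of_real pi * \<i> * of_int \<lfloor>x\<rfloor> - of_real pi * \<i>"
  have eq: "theta_logderiv \<tau> (of_real x * \<tau> + of_real y) =
      c + (- 2 * of_real pi * \<i>) * ?L \<tau> + (2 * of_real pi * \<i>) * ?L' \<tau>" if tau: "Im \<tau> > 0" for \<tau>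
  proof -
    have ne: "frac x \<notin> \<int> \<or> y \<notin> \<int>" using assms by (simp add: frac_def)
    have "of_real x * \<tau> + of_real y = (of_real (frac x) * \<tau> + of_real y) + (of_int \<lfloor>x\<rfloor> * \<tau> + of_int 0)"
      by (simp add: frac_def algebra_simps)
    moreover have "of_real (frac x) * \<tau> + of_real y \<notin> lattice \<tau>"
      using ne tau by (simp add: real_point_in_lattice_iff)
    ultimately have "theta_logderiv \<tau> (of_real x * \<tau> + of_real y) =
       theta_logderiv \<tau> (of_real (frac x) * \<tau> + of_real y) - 2 * of_real pi * \<i> * of_int \<lfloor>x\<rfloor>"
      using theta_logderiv_add_lattice[OF tau] by metis
    then show ?thesis
      unfolding theta_logderiv_series_on_line[OF tau ne] by (simp add: c_def)
  qed
  from bounded_at_ii_inf_lincomb[OF 1 2] obtain B where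
    "eventually (\<lambda>\<tau>. norm (c + (- 2 * of_real pi * \<i>) * ?L \<tau> + (2 * of_real pi * \<i>) * ?L' \<tau>) \<le> B) at_ii_inf"
    by blast
  with eventually_Im_pos have "eventually (\<lambda>\<tau>. norm (theta_logderiv \<tau> (of_real x * \<tau> + of_real y)) \<le> B) at_ii_inf"
    by eventually_elim (simp only: eq)
  then show ?thesis ..
qed

section \<open>Modularity of the division values\<close>

lemma modular_form_add:
  assumes "modular_form w n f" "modular_form w n g"
  shows "modular_form w n (\<lambda>\<tau>. f \<tau> + g \<tau>)"
proof -
  have slash_add: "slash w A (\<lambda>\<tau>. f \<tau> + g \<tau>) \<tau> = slash w A f \<tau> + slash w A g \<tau>" for A \<tau>
    by (simp add: slash_def distrib_left)
  have "\<exists>B. eventually (\<lambda>\<tau>. norm (slash w A (\<lambda>\<tau>. f \<tau> + g \<tau>) \<tau>) \<le> B) at_ii_inf" if "A \<in> SL2Z" for A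
    using bounded_at_ii_inf_lincomb[of "slash w A f" "slash w A g" 0 1 1] assms that
    by (simp add: modular_form_def slash_add)
  with assms show ?thesis
    by (auto simp: modular_form_def slash_add intro!: holomorphic_intros)
qed

lemma modular_form_minus:
  assumes "modular_form w n f"
  shows "modular_form w n (\<lambda>\<tau>. - f \<tau>)"
proof -
  have "slash w A (\<lambda>\<tau>. - f \<tau>) \<tau> = - slash w A f \<tau>" for A \<tau>
    by (simp add: slash_def)
  with assms show ?thesis
    by (auto simp: modular_form_def intro!: holomorphic_intros)
qed

lemma s_eq_theta_logderiv: "s n a \<tau> = theta_logderiv \<tau> (of_int a / of_nat n)"
  by (simp add: s_def theta_logderiv_def)

lemma of_int_div_in_Ints_iff:
  assumes "n > 0"
  shows "(of_int a / of_nat n :: real) \<in> \<int> \<longleftrightarrow> [a = 0] (mod int n)"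
proof
  assume "(of_int a / of_nat n :: real) \<in> \<int>"
  then obtain m where "(of_int a / of_nat n :: real) = of_int m" by (auto elim: Ints_cases)
  then have "(of_int a :: real) = of_int (m * int n)" using assms by (simp add: field_simps)
  then have "a = m * int n" by (simp only: of_int_eq_iff)
  then show "[a = 0] (mod int n)" by (simp add: cong_0_iff)
next
  assume "[a = 0] (mod int n)"
  then obtain m where "a = int n * m" by (auto simp: cong_0_iff)
  then show "(of_int a / of_nat n :: real) \<in> \<int>" using assms by simp
qed

lemma of_int_div_notin_lattice:
  assumes "n > 0" "Im \<tau> > 0" "\<not> [a = 0] (mod int n)"
  shows "of_int a / of_nat n \<notin> lattice \<tau>"
  using real_point_in_lattice_iff[OF assms(2), of 0 "of_int a / of_nat n"] assms
  by (simp add: of_int_div_in_Ints_iff)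

lemma s_holomorphic:
  assumes n: "n > 0" and a: "\<not> [a = 0] (mod int n)"
  shows "s n a holomorphic_on upper_half_plane"
proof -
  define y :: real where "y = of_int a / of_nat n"
  have y: "y \<notin> \<int>" using of_int_div_in_Ints_iff[OF n] a by (simp add: y_def)
  have eq: "s n a \<tau> = - (of_real pi * \<i>)
      - 2 * of_real pi * \<i> * log_series \<tau> (of_real 0 * \<tau> + of_real y)
      + 2 * of_real pi * \<i> * log_series \<tau> (of_real 1 * \<tau> + of_real (- y))"
    if "\<tau> \<in> upper_half_plane" for \<tau>
    using that theta_logderiv_series_on_line[of \<tau> 0 y] y
    by (simp add: s_eq_theta_logderiv upper_half_plane_def y_def)
  have "(\<lambda>\<tau>. - (of_real pi * \<i>)
      - 2 * of_real pi * \<i> * log_series \<tau> (of_real 0 * \<tau> + of_real y)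
      + 2 * of_real pi * \<i> * log_series \<tau> (of_real 1 * \<tau> + of_real (- y))) holomorphic_on upper_half_plane"
    by (intro holomorphic_intros log_series_holomorphic) (use y in auto)
  then show ?thesis
    by (rule holomorphic_transform) (simp only: eq)
qed

text \<open>
  The law \<open>theta_logderiv_moebius\<close> at $u = a/n$: dividing by $j = c\tau + d$ removes the
  automorphy factor and leaves an additive constant.
\<close>
lemma slash_s:
  assumes n: "n > 0" and a: "\<not> [a = 0] (mod int n)" and A: "A \<in> SL2Z" and tau: "Im \<tau> > 0"
  shows "slash 1 A (s n a) \<tau> =
    theta_logderiv \<tau> (of_int (A $ 2 $ 1 * a) / of_nat n * \<tau> + of_int (A $ 2 $ 2 * a) / of_nat n)
      + 2 * of_real pi * \<i> * of_int (A $ 2 $ 1 * a) / of_nat n"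
proof -
  let ?j = "of_int (A $ 2 $ 1) * \<tau> + of_int (A $ 2 $ 2)"
  have det: "A $ 1 $ 1 * A $ 2 $ 2 - A $ 1 $ 2 * A $ 2 $ 1 = 1"
    using A by (simp add: SL2Z_def det_2)
  have j: "?j \<noteq> 0" by (rule moebius_denominator_nonzero[OF tau det])
  have "of_int a / of_nat n \<notin> lattice (moebius_act A \<tau>)"
    unfolding moebius_act_def by (intro of_int_div_notin_lattice n a moebius_Im[OF tau det])
  then have "s n a (moebius_act A \<tau>) = ?j * theta_logderiv \<tau> (?j * (of_int a / of_nat n)) +
      2 * of_real pi * \<i> * of_int (A $ 2 $ 1) * (?j * (of_int a / of_nat n))"
    unfolding s_eq_theta_logderiv moebius_act_def by (rule theta_logderiv_moebius[OF tau det])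
  then have "slash 1 A (s n a) \<tau> = theta_logderiv \<tau> (?j * (of_int a / of_nat n)) +
      2 * of_real pi * \<i> * of_int (A $ 2 $ 1) * (of_int a / of_nat n)"
    unfolding slash_def using j by (simp add: power_int_minus divide_simps) (simp add: algebra_simps)
  moreover have "?j * (of_int a / of_nat n) =
      of_int (A $ 2 $ 1 * a) / of_nat n * \<tau> + of_int (A $ 2 $ 2 * a) / of_nat n"
    using n by (simp add: field_simps)
  ultimately show ?thesis by simp
qed

text \<open>
  For $A \in \Gamma_1(n)$ with $c = nc'$ and $d = 1 + nd'$, the new argument is
  $a/n + c'a\tau + d'a$; quasi-periodicity contributes $-2\pi i c'a$, which is the negative of the constant
  $2\pi i ca/n$. At the other cusps, $ca/n$ and $da/n$ are not both integers, since $c$ and $d$ are coprime and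
  $n$ does not divide $a$; so the growth estimate applies.
\<close>
theorem s_modular_form:
  assumes n: "n > 0" and a: "\<not> [a = 0] (mod int n)"
  shows "modular_form 1 n (s n a)"
  unfolding modular_form_def
proof (intro conjI ballI)
  show "s n a holomorphic_on upper_half_plane"
    by (rule s_holomorphic[OF n a])
next
  fix A \<tau> assume A: "A \<in> Gamma1 n" and "\<tau> \<in> upper_half_plane"
  then have tau: "Im \<tau> > 0" and A': "A \<in> SL2Z"
    by (auto simp: upper_half_plane_def Gamma1_def)
  from A have "int n dvd A $ 2 $ 1" "int n dvd A $ 2 $ 2 - 1"
    by (auto simp: Gamma1_def cong_0_iff cong_iff_dvd_diff)
  then obtain c' d' where c': "A $ 2 $ 1 = int n * c'" and "A $ 2 $ 2 - 1 = int n * d'"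
    by (auto elim!: dvdE)
  then have d': "A $ 2 $ 2 = 1 + int n * d'" by simp
  have arg: "of_int (A $ 2 $ 1 * a) / of_nat n * \<tau> + of_int (A $ 2 $ 2 * a) / of_nat n =
      of_int a / of_nat n + (of_int (c' * a) * \<tau> + of_int (d' * a))"
    using n by (simp add: c' d' field_simps)
  show "slash 1 A (s n a) \<tau> = s n a \<tau>"
    unfolding slash_s[OF n a A' tau] arg
      theta_logderiv_add_lattice[OF tau of_int_div_notin_lattice[OF n tau a]] s_eq_theta_logderiv
    using n by (simp add: c')
next
  fix A assume A: "A \<in> SL2Z"
  define x y :: real where "x = of_int (A $ 2 $ 1 * a) / of_nat n" and "y = of_int (A $ 2 $ 2 * a) / of_nat n"
  have "x \<notin> \<int> \<or> y \<notin> \<int>"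
  proof (rule ccontr)
    assume "\<not> ?thesis"
    then have "int n dvd A $ 2 $ 1 * a" "int n dvd A $ 2 $ 2 * a"
      unfolding x_def y_def of_int_div_in_Ints_iff[OF n] cong_0_iff by auto
    then have "int n dvd A $ 1 $ 1 * (A $ 2 $ 2 * a) - A $ 1 $ 2 * (A $ 2 $ 1 * a)"
      by (intro dvd_diff) (rule dvd_mult, assumption)+
    also have "\<dots> = (A $ 1 $ 1 * A $ 2 $ 2 - A $ 1 $ 2 * A $ 2 $ 1) * a"
      by (simp add: algebra_simps)
    also have "\<dots> = a" using A by (simp add: SL2Z_def det_2)
    finally show False using a by (simp add: cong_0_iff)
  qed
  then obtain B where B: "eventually (\<lambda>\<tau>. norm (theta_logderiv \<tau> (of_real x * \<tau> + of_real y)) \<le> B) at_ii_inf"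
    using theta_logderiv_bounded_at_ii_inf by blast
  from B eventually_Im_pos
  have "eventually (\<lambda>\<tau>. norm (slash 1 A (s n a) \<tau>) \<le> B + norm (2 * of_real pi * \<i> * of_real x)) at_ii_inf"
  proof eventually_elim
    case (elim \<tau>)
    have "slash 1 A (s n a) \<tau> = theta_logderiv \<tau> (of_real x * \<tau> + of_real y) + 2 * of_real pi * \<i> * of_real x"
      unfolding slash_s[OF n a A elim(2)] by (simp add: x_def y_def)
    then show ?case
      using norm_triangle_mono[OF elim(1) order_refl] by simp
  qed
  then show "\<exists>B. eventually (\<lambda>\<tau>. norm (slash 1 A (s n a) \<tau>) \<le> B) at_ii_inf" ..
qed

section \<open>Absence of zeros in the upper half-plane\<close>

text \<open>
  The group maps interior points to interior points. So if an orbit contains a boundary point, then any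
  chosen representative of it is a boundary point.
\<close>
lemma zeros_X1_subset_cusps:
  assumes "\<And>\<tau>. \<tau> \<in> upper_half_plane \<Longrightarrow> f \<tau> \<noteq> 0"
  shows "zeros_X1 w n f \<subseteq> cusps n"
proof
  fix X assume "X \<in> zeros_X1 w n f"
  then obtain p q where X: "X = Gamma1_rel n `` {q}" and q: "q \<in> hstar"
    and p: "p \<in> X" "vanishes_at w f p"
    by (auto simp: zeros_X1_def X1_def quotient_def)
  from p(1) X have "p \<in> hstar" and rel: "\<exists>A. p = ext_act A q"
    by (auto simp: Gamma1_rel_def)
  have "q \<in> boundary_points"
  proof (rule ccontr)
    assume "q \<notin> boundary_points"
    with q obtain \<tau> where "q = Interior \<tau>" by (auto simp: hstar_def)
    with rel obtain \<tau>' where p': "p = Interior \<tau>'" by auto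
    with \<open>p \<in> hstar\<close> have "\<tau>' \<in> upper_half_plane"
      by (auto simp: hstar_def boundary_points_def)
    with assms p(2) p' show False by (simp add: vanishes_at_def)
  qed
  with X show "X \<in> cusps n"
    by (auto simp: cusps_def quotient_def)
qed

lemma s_combination_nonzero:
  assumes n: "n > 0" and tau: "Im \<tau> > 0"
    and "\<not> [a = 0] (mod int n)" "\<not> [b = 0] (mod int n)" "\<not> [a = b] (mod int n)"
    and "\<not> [k = a - b] (mod int n)" "\<not> [k = 0] (mod int n)"
    and "\<not> [k = a] (mod int n)" "\<not> [k = - b] (mod int n)"
  shows "s n (k + b - a) \<tau> - s n k \<tau> - s n b \<tau> + s n a \<tau> \<noteq> 0"
proof -
  \<comment> \<open>Sums of division points are again division points, so arguments are handled through their numerators.\<close>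
  define p :: "int \<Rightarrow> complex" where "p = (\<lambda>i. of_int i / of_nat n)"
  have p_add: "p i + p j = p (i + j)" for i j
    by (simp add: p_def add_divide_distrib)
  have notin: "p i \<notin> lattice \<tau>" if "\<not> [i = 0] (mod int n)" for i
    unfolding p_def by (rule of_int_div_notin_lattice[OF n tau that])
  have ncong: "\<not> [- a = 0] (mod int n)" "\<not> [b - a = 0] (mod int n)" "\<not> [k + b - a = 0] (mod int n)"
    "\<not> [k + b = 0] (mod int n)" "\<not> [k - a = 0] (mod int n)"
    using assms(3-) by (simp_all add: cong_iff_dvd_diff algebra_simps dvd_diff_commute)
  have s: "s n i \<tau> = theta_logderiv \<tau> (p i)" for i
    by (simp add: s_eq_theta_logderiv p_def)
  have "s n a \<tau> = - theta_logderiv \<tau> (p (- a))"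
    using theta_logderiv_minus[OF tau, of "p a"] by (simp add: s p_def)
  then have "s n (k + b - a) \<tau> - s n k \<tau> - s n b \<tau> + s n a \<tau> =
    - (theta_logderiv \<tau> (p k) + theta_logderiv \<tau> (p b) + theta_logderiv \<tau> (p (- a)) -
       theta_logderiv \<tau> (p k + p b + p (- a)))"
    by (simp add: s p_add)
  also have "\<dots> = - (theta_z 0 \<tau> * theta (p k + p b) \<tau> * theta (p b + p (- a)) \<tau> * theta (p (- a) + p k) \<tau> /
      (theta (p k) \<tau> * theta (p b) \<tau> * theta (p (- a)) \<tau> * theta (p k + p b + p (- a)) \<tau>))"
    by (subst theta_logderiv_addition[OF tau]) (use notin ncong assms in \<open>simp_all add: p_add\<close>)
  also have "\<dots> \<noteq> 0"
    using notin ncong assms theta_z_0_nonzero[OF tau]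
    by (simp add: p_add theta_eq_0_iff[OF tau])
  finally show ?thesis .
qed

theorem corollary4p6:
  fixes n :: nat and a b k :: int
  assumes "n \<ge> 3"
    and "\<not> [a = 0] (mod int n)" and "\<not> [b = 0] (mod int n)"
    and "\<not> [a = b] (mod int n)" and "\<not> [a = - b] (mod int n)"
    and "\<not> [k = a - b] (mod int n)" and "\<not> [k = 0] (mod int n)"
    and "\<not> [k = a] (mod int n)" and "\<not> [k = - b] (mod int n)"
  defines "f \<equiv> \<lambda>\<tau>. s n (k + b - a) \<tau> - s n k \<tau> - s n b \<tau> + s n a \<tau>"
  shows "modular_form 1 n f \<and> zeros_X1 1 n f \<subseteq> cusps n"
proof
  have n: "n > 0" using assms(1) by simp
  have "\<not> [k + b - a = 0] (mod int n)"
    using assms(6) by (simp add: cong_iff_dvd_diff algebra_simps)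
  then have "modular_form 1 n (\<lambda>\<tau>. s n (k + b - a) \<tau> + - s n k \<tau> + - s n b \<tau> + s n a \<tau>)"
    using assms n by (intro modular_form_add modular_form_minus s_modular_form)
  then show "modular_form 1 n f"
    by (simp add: f_def)
  show "zeros_X1 1 n f \<subseteq> cusps n"
    unfolding f_def
    by (intro zeros_X1_subset_cusps s_combination_nonzero n)
      (use assms in \<open>auto simp: upper_half_plane_def\<close>)
qed

end
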